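(* Let $n\ge 2$ and $m>2n+2$ be integers, and let $F:\mathbb{B}^n\to D^{IV}_m$ be a holomorphic isometry. Then there exists a holomorphic isometry $G:\mathbb{B}^n\to D^{IV}_{2n+2}$ such that $F$ is equivalent to the map $(G,\mathbf 0):\mathbb{B}^n\to D^{IV}_m$, where $\mathbf 0$ is the zero vector in $\mathbb{C}^{m-2n-2}$.
   Context: $\mathbb{B}^n=\{z\in\mathbb{C}^n: |z|^2<1\}$. For a row vector $Z=(z_1,\dots,z_m)\in\mathbb{C}^m$, the type IV classical domain is $D^{IV}_m=\{Z\in\mathbb{C}^m: Z\overline{Z}^t<2,\ 1-Z\overline{Z}^t+\tfrac14|ZZ^t|^2>0\}$; its Bergman kernel is $K(Z,\bar Z)=c\,(1-Z\overline{Z}^t+\tfrac14|ZZ^t|^2)^{-m}$ ($c>0$ a constant), and the Bergman kernel of $\mathbb{B}^n$ is a positive constant times $(1-|z|^2)^{-(n+1)}$. For a bounded domain $\Omega$ with Bergman kernel $K_\Omega$, its Bergman metric is $\omega_\Omega=\sqrt{-1}\partial\bar\partial\log K_\Omega(Z,\bar Z)$. A holomorphic map $F:D\to\Omega$ between such domains is a holomorphic isometry if $F^*\omega_\Omega=\lambda\,\omega_D$ for some positive constant $\lambda$. Two holomorphic maps $F_1,F_2:\mathbb{B}^n\to D^{IV}_m$ are equivalent if $F_1=\phi\circ F_2\circ\psi$ for some biholomorphic automorphisms $\psi$ of $\mathbb{B}^n$ and $\phi$ of $D^{IV}_m$. Note $D^{IV}_{k}\times\{0\}\subset D^{IV}_m$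 for $k\le m$. *)

theory Defs
  imports "HOL-Analysis.Analysis"
begin

definition holo_map :: "(complex^'a \<Rightarrow> complex^'b) \<Rightarrow> (complex^'a) set \<Rightarrow> bool" where
  "holo_map F S \<longleftrightarrow> (\<forall>z\<in>S. \<exists>L. (F has_derivative L) (at z) \<and>
                       (\<forall>(c::complex) v. L (c *s v) = c *s L v))"

definition unit_ball :: "(complex^'n) set" where
  "unit_ball = {z. (\<Sum>i\<in>UNIV. (cmod (z $ i))\<^sup>2) < 1}"

definition zzbar :: "complex^'m \<Rightarrow> real" where
  "zzbar Z = (\<Sum>i\<in>UNIV. (cmod (Z $ i))\<^sup>2)"

definition zzt :: "complex^'m \<Rightarrow> complex" where
  "zzt Z = (\<Sum>i\<in>UNIV. (Z $ i)\<^sup>2)"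

definition typeIV :: "(complex^'m) set" where
  "typeIV = {Z. zzbar Z < 2 \<and> 1 - zzbar Z + 1/4 * (cmod (zzt Z))\<^sup>2 > 0}"

text \<open>log of the Bergman kernels on the diagonal (the positive normalising constants c
  only add a constant to the logarithm, which is annihilated by the d d-bar operator;
  we take c = 1).\<close>
definition log_bergman_ball :: "complex^'n \<Rightarrow> real" where
  "log_bergman_ball z = ln ((1 - (\<Sum>i\<in>UNIV. (cmod (z $ i))\<^sup>2)) powr (- real (CARD('n) + 1)))"

definition log_bergman_typeIV :: "complex^'m \<Rightarrow> real" where
  "log_bergman_typeIV Z = ln ((1 - zzbar Z + 1/4 * (cmod (zzt Z))\<^sup>2) powr (- real CARD('m)))"

text \<open>Levi form (complex Hessian) of a real function phi at Z in direction v: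
  sum_{j,k} d^2 phi/(dz_j d conj z_k) v_j conj(v_k) = (1/4) Laplacian of zeta |-> phi(Z + zeta v) at 0.
  The Kaehler form sqrt(-1) d d-bar phi corresponds to this Hermitian form.\<close>
definition levi :: "(complex^'m \<Rightarrow> real) \<Rightarrow> complex^'m \<Rightarrow> complex^'m \<Rightarrow> real" where
  "levi phi Z v = 1/4 * (deriv (deriv (\<lambda>s::real. phi (Z + complex_of_real s *s v))) 0
                       + deriv (deriv (\<lambda>t::real. phi (Z + (\<i> * complex_of_real t) *s v))) 0)"

text \<open>Holomorphic isometry F : D \<rightarrow> Omega (up to a constant factor lambda > 0) w.r.t.
  the Kaehler metrics sqrt(-1) d d-bar phiD and sqrt(-1) d d-bar phiO: F^* omega_Omega = lambda omega_D.\<close>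
definition holo_isometry ::
  "(complex^'a \<Rightarrow> complex^'b) \<Rightarrow> (complex^'a) set \<Rightarrow> (complex^'a \<Rightarrow> real)
     \<Rightarrow> (complex^'b) set \<Rightarrow> (complex^'b \<Rightarrow> real) \<Rightarrow> bool" where
  "holo_isometry F D phiD Om phiO \<longleftrightarrow>
     holo_map F D \<and> F ` D \<subseteq> Om \<and>
     (\<exists>lam>0. \<forall>z\<in>D. \<forall>v. levi phiO (F z) (frechet_derivative F (at z) v) = lam * levi phiD z v)"

definition biholo_aut :: "(complex^'a \<Rightarrow> complex^'a) \<Rightarrow> (complex^'a) set \<Rightarrow> bool" where
  "biholo_aut f S \<longleftrightarrow> bij_betw f S S \<and> holo_map f S \<and> holo_map (inv_into S f) S"

definition equiv_maps :: "(complex^'n \<Rightarrow> complex^'m) \<Rightarrow> (complex^'n \<Rightarrow> complex^'m) \<Rightarrow> bool" where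
  "equiv_maps F1 F2 \<longleftrightarrow> (\<exists>psi phi. biholo_aut psi unit_ball \<and> biholo_aut phi typeIV \<and>
       (\<forall>z\<in>unit_ball. F1 z = phi (F2 (psi z))))"

text \<open>Zero padding (W, 0): C^k \<rightarrow> C^m along an injective index embedding e.\<close>
definition pad :: "('k \<Rightarrow> 'm) \<Rightarrow> complex^'k \<Rightarrow> complex^'m" where
  "pad e W = (\<chi> i. if i \<in> range e then W $ (inv e i) else 0)"

end

theory Submission
  imports Defs "HOL-Complex_Analysis.Conformal_Mappings"
begin

text \<open>
  Let \<open>N Z = 1 - |Z|\<^sup>2 + |Z Z\<^sup>t|\<^sup>2 / 4\<close> (\<open>gen_norm\<close>). Since the automorphism group of the domain is transitive
  and changes \<open>N\<close> only by the squared modulus of a holomorphic factor, one may assume \<open>F 0 = 0\<close>. On each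
  complex line through \<open>0\<close> the metric equation says that \<open>ln N(F) - \<mu> ln (1 - |z|\<^sup>2)\<close> is harmonic;
  polarization together with \<open>F 0 = 0\<close> turns this into \<open>N (F z) = (1 - |z|\<^sup>2)\<^sup>\<mu>\<close>, and polarization along
  arbitrary complex lines gives the corresponding identity for two points \<open>z\<close>, \<open>w\<close>.

  Comparing Taylor coefficients yields \<open>\<mu> = 1\<close>: for \<open>\<mu> < 1\<close> the coefficients of \<open>F\<close> along one axis would be
  infinitely many independent vectors, and for \<open>\<mu> > 1\<close> the second order coefficients along two axes
  violate the Cauchy-Schwarz inequality.

  Now \<open>\<langle>F z, F w\<rangle> = \<langle>z, w\<rangle> + f z \<cdot> cnj (f w)\<close> with \<open>f = F F\<^sup>t / 2\<close>, so the image of \<open>F\<close> spans a complex space of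
  dimension at most \<open>n + 1\<close>. The real parts of that space span at most \<open>2 n + 2\<close> real dimensions, and a real
  orthogonal matrix, which acts on the domain, rotates them into the given coordinates.
\<close>

subsection \<open>Levi form of the logarithm of a Hermitian norm\<close>

text \<open>The doubling from \<open>n + 1\<close> to \<open>2 n + 2\<close> is forced by the
  method: a linear map keeping both \<open>zzbar\<close> and \<open>zzt\<close> is unitary and
  complex orthogonal, hence real orthogonal. A unitary matrix moving the complex span of the image
  into the first coordinates would in general destroy \<open>zzt\<close>, so real and imaginary
  parts have to be moved together.

  All analysis is done in one complex variable. Any two points of the ball lie on a complex line,
  and such a line meets the ball in a round disc, so polarization on discs reaches every pair of
  points.

  The value of \<mu> is decided by signs. Along orthogonal axes, the derivatives of order
  \<open>k\<close> of the normalised map at 0 have as Gram matrix a rank one matrix minus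
  \<open>C k\<close> times the identity, where \<open>C k = pochhammer (- \<mu>) k * fact k\<close>.
  If \<mu> < 1, every \<open>C k\<close> with \<open>k > 0\<close> is negative and the vectors of
  all orders on one axis are independent. If \<mu> > 1, \<open>C 2\<close> is positive, and a rank
  one matrix minus a positive multiple of the identity is not positive semidefinite in size two;
  this is where \<open>n \<ge> 2\<close> enters.\<close>

lemma deriv_deriv_eqI:
  fixes f f1 :: "real \<Rightarrow> real"
  assumes "r > 0" "\<And>s. \<bar>s\<bar> < r \<Longrightarrow> (f has_real_derivative f1 s) (at s)" "(f1 has_real_derivative d) (at 0)"
  shows "deriv (deriv f) 0 = d"
proof -
  have "eventually (\<lambda>s. s \<in> {-r<..<r}) (nhds 0)"
    using assms(1) by (intro eventually_nhds_in_open) auto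
  hence "eventually (\<lambda>s. deriv f s = f1 s) (nhds 0)"
    by eventually_elim (auto intro!: DERIV_imp_deriv assms(2))
  hence "deriv (deriv f) 0 = deriv f1 0"
    by (intro deriv_cong_ev) auto
  thus ?thesis using DERIV_imp_deriv[OF assms(3)] by simp
qed

lemma has_vector_derivative_along_line:
  assumes "(f has_field_derivative f') (at (u * complex_of_real s))"
  shows "((\<lambda>s. f (u * complex_of_real s)) has_vector_derivative f' * u) (at s)"
proof -
  have 1: "((\<lambda>s. u * complex_of_real s) has_vector_derivative u) (at s)"
    by (auto intro!: derivative_eq_intros simp: has_vector_derivative_def scaleR_conv_of_real)
  show ?thesis
    using field_vector_diff_chain_at[OF 1 assms] by (simp add: o_def mult.commute)
qed

lemma has_real_derivative_Re:
  "(g has_vector_derivative g') (at s) \<Longrightarrow> ((\<lambda>s. Re (g s)) has_real_derivative Re g') (at s)"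
  by (auto simp: has_vector_derivative_def has_field_derivative_def intro!: derivative_eq_intros)

lemma has_vector_derivative_mult_cnj:
  assumes "(f has_vector_derivative f') (at s)" "(g has_vector_derivative g') (at s)"
  shows "((\<lambda>s. f s * cnj (g s)) has_vector_derivative f s * cnj g' + f' * cnj (g s)) (at s)"
proof -
  have "((\<lambda>s. cnj (g s)) has_vector_derivative cnj g') (at s)"
    using bounded_linear.has_vector_derivative[OF bounded_linear_cnj assms(2)] .
  from has_vector_derivative_mult[OF assms(1) this] show ?thesis .
qed

lemma cmod_sq_eq: "(cmod z)\<^sup>2 = Re (z * cnj z)"
  by (simp add: cmod_power2 flip: power2_eq_square)

text \<open>With \<open>M s\<close> the norm at \<open>u * s\<close>, one has
  \<open>M' = 2 Re (S1 u)\<close> and, as \<open>u\<close> is unimodular,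
  \<open>M'' = 2 Re (S2 u^2) + 2 S11\<close> at 0; the claim is
  \<open>(ln M)'' = M'' / M - (M' / M)^2\<close>. Second derivatives of the holomorphic functions
  occur only in \<open>S2\<close>.\<close>

lemma deriv_deriv_ln_direction:
  fixes P :: "'i::finite \<Rightarrow> complex \<Rightarrow> complex" and q :: "complex \<Rightarrow> complex"
    and phi :: "complex \<Rightarrow> real"
  assumes r: "r > 0" and holP: "\<And>i. P i holomorphic_on ball 0 r" and holq: "q holomorphic_on ball 0 r"
    and pos: "\<And>x. x \<in> ball 0 r \<Longrightarrow> 1 - (\<Sum>i\<in>UNIV. (cmod (P i x))\<^sup>2) + (cmod (q x))\<^sup>2 > 0"
    and phi: "\<And>x. x \<in> ball 0 r \<Longrightarrow> phi x = k * ln (1 - (\<Sum>i\<in>UNIV. (cmod (P i x))\<^sup>2) + (cmod (q x))\<^sup>2)"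
    and u: "cmod u = 1"
  defines "N \<equiv> 1 - (\<Sum>i\<in>UNIV. (cmod (P i 0))\<^sup>2) + (cmod (q 0))\<^sup>2"
    and "S1 \<equiv> - (\<Sum>i\<in>UNIV. deriv (P i) 0 * cnj (P i 0)) + deriv q 0 * cnj (q 0)"
    and "S2 \<equiv> - (\<Sum>i\<in>UNIV. deriv (deriv (P i)) 0 * cnj (P i 0)) + deriv (deriv q) 0 * cnj (q 0)"
    and "S11 \<equiv> - (\<Sum>i\<in>UNIV. (cmod (deriv (P i) 0))\<^sup>2) + (cmod (deriv q 0))\<^sup>2"
  shows "deriv (deriv (\<lambda>s. phi (u * of_real s))) 0 
    = k * ((2 * Re (S2 * u\<^sup>2) + 2 * S11) / N - (2 * Re (S1 * u))\<^sup>2 / N\<^sup>2)"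
proof -
  define M where "M = (\<lambda>s::real. 1 - (\<Sum>i\<in>UNIV. (cmod (P i (u * of_real s)))\<^sup>2) + (cmod (q (u * of_real s)))\<^sup>2)"
  define M1 where "M1 = (\<lambda>s::real. 2 * Re (u * (- (\<Sum>i\<in>UNIV. deriv (P i) (u * of_real s) * cnj (P i (u * of_real s))) 
       + deriv q (u * of_real s) * cnj (q (u * of_real s)))))"
  have inb: "u * of_real s \<in> ball 0 r" if "\<bar>s\<bar> < r" for s
    using that u by (simp add: norm_mult)
  have sq: "((\<lambda>s. (cmod (f (u * of_real s)))\<^sup>2) has_real_derivative 
       2 * Re (u * (deriv f (u * of_real s) * cnj (f (u * of_real s))))) (at s)"
    if "\<bar>s\<bar> < r" "f holomorphic_on ball 0 r" for s f
  proof -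
    have "(f has_field_derivative deriv f (u * of_real s)) (at (u * of_real s))"
      using that inb by (intro holomorphic_derivI[of _ "ball 0 r"]) auto
    note v = has_vector_derivative_along_line[OF this]
    from has_real_derivative_Re[OF has_vector_derivative_mult_cnj[OF v v]]
    show ?thesis unfolding cmod_sq_eq
      by (rule DERIV_cong) (simp add: algebra_simps)
  qed
  have M: "(M has_real_derivative M1 s) (at s)" if "\<bar>s\<bar> < r" for s
  proof -
    have "(M has_real_derivative 0 - (\<Sum>i\<in>UNIV. 2 * Re (u * (deriv (P i) (u * of_real s) * cnj (P i (u * of_real s)))))
        + 2 * Re (u * (deriv q (u * of_real s) * cnj (q (u * of_real s))))) (at s)"
      unfolding M_def by (intro DERIV_add DERIV_diff DERIV_const DERIV_sum sq that holP holq)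
    moreover have "M1 s = 2 * (- (\<Sum>i\<in>UNIV. Re (u * (deriv (P i) (u * of_real s) * cnj (P i (u * of_real s)))))
       + Re (u * (deriv q (u * of_real s) * cnj (q (u * of_real s)))))"
      unfolding M1_def by (simp only: ring_distribs sum_distrib_left minus_mult_right[symmetric] plus_complex.sel uminus_complex.sel Re_sum)
    ultimately show ?thesis by (simp only: sum_distrib_left ring_distribs minus_mult_right[symmetric] diff_0)
  qed
  have Mpos: "M s > 0" if "\<bar>s\<bar> < r" for s
    unfolding M_def using pos[OF inb[OF that]] .
  have sq2: "((\<lambda>s. Re (u * (deriv f (u * of_real s) * cnj (f (u * of_real s))))) has_real_derivative
       Re (u\<^sup>2 * (deriv (deriv f) 0 * cnj (f 0))) + (cmod (deriv f 0))\<^sup>2) (at 0)"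
    if "f holomorphic_on ball 0 r" for f
  proof -
    have "(f has_field_derivative deriv f 0) (at 0)"
      using that r by (intro holomorphic_derivI[of _ "ball 0 r"]) auto
    hence v: "((\<lambda>s. f (u * of_real s)) has_vector_derivative deriv f 0 * u) (at 0)"
      using has_vector_derivative_along_line[of f _ u 0] by simp
    have "(deriv f has_field_derivative deriv (deriv f) 0) (at 0)"
      using that r by (intro holomorphic_derivI[of _ "ball 0 r"] holomorphic_deriv) auto
    hence v': "((\<lambda>s. deriv f (u * of_real s)) has_vector_derivative deriv (deriv f) 0 * u) (at 0)"
      using has_vector_derivative_along_line[of "deriv f" _ u 0] by simp
    have uu: "u * cnj u = 1" using u by (simp add: complex_norm_square[symmetric])
    have e: "u * (deriv f 0 * (cnj (deriv f 0) * cnj u)) = deriv f 0 * cnj (deriv f 0)"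
      using uu by (simp add: mult_ac)
    have e': "u * (deriv f 0 * cnj (deriv f 0 * u) + deriv (deriv f) 0 * u * cnj (f 0))
        = u\<^sup>2 * (deriv (deriv f) 0 * cnj (f 0)) + deriv f 0 * cnj (deriv f 0)"
      using e by (simp add: ring_distribs power2_eq_square)
    from has_real_derivative_Re[OF has_vector_derivative_mult_right[OF has_vector_derivative_mult_cnj[OF v' v], of u]]
    show ?thesis unfolding cmod_sq_eq
      by (rule DERIV_cong) (simp only: e' plus_complex.sel mult_zero_right of_real_0)
  qed
  have M1: "(M1 has_real_derivative 2 * Re (S2 * u\<^sup>2) + 2 * S11) (at 0)"
  proof -
    have "M1 = (\<lambda>s. 2 * (- (\<Sum>i\<in>UNIV. Re (u * (deriv (P i) (u * of_real s) * cnj (P i (u * of_real s)))))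
       + Re (u * (deriv q (u * of_real s) * cnj (q (u * of_real s))))))"
      unfolding M1_def by (simp only: ring_distribs sum_distrib_left minus_mult_right[symmetric] plus_complex.sel uminus_complex.sel Re_sum)
    moreover have "((\<lambda>s. 2 * (- (\<Sum>i\<in>UNIV. Re (u * (deriv (P i) (u * of_real s) * cnj (P i (u * of_real s)))))
       + Re (u * (deriv q (u * of_real s) * cnj (q (u * of_real s)))))) has_real_derivative
       2 * (- (\<Sum>i\<in>UNIV. Re (u\<^sup>2 * (deriv (deriv (P i)) 0 * cnj (P i 0))) + (cmod (deriv (P i) 0))\<^sup>2)
         + (Re (u\<^sup>2 * (deriv (deriv q) 0 * cnj (q 0))) + (cmod (deriv q 0))\<^sup>2))) (at 0)"
      by (intro DERIV_cmult DERIV_add DERIV_minus DERIV_sum sq2 holP holq)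
    moreover have "2 * (- (\<Sum>i\<in>UNIV. Re (u\<^sup>2 * (deriv (deriv (P i)) 0 * cnj (P i 0))) + (cmod (deriv (P i) 0))\<^sup>2)
         + (Re (u\<^sup>2 * (deriv (deriv q) 0 * cnj (q 0))) + (cmod (deriv q 0))\<^sup>2)) = 2 * Re (S2 * u\<^sup>2) + 2 * S11"
    proof -
      have "S2 * u\<^sup>2 = - (\<Sum>i\<in>UNIV. u\<^sup>2 * (deriv (deriv (P i)) 0 * cnj (P i 0))) + u\<^sup>2 * (deriv (deriv q) 0 * cnj (q 0))"
        unfolding S2_def by (simp add: ring_distribs sum_distrib_left mult_ac)
      hence "Re (S2 * u\<^sup>2) = - (\<Sum>i\<in>UNIV. Re (u\<^sup>2 * (deriv (deriv (P i)) 0 * cnj (P i 0)))) + Re (u\<^sup>2 * (deriv (deriv q) 0 * cnj (q 0)))"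
        by (simp only: plus_complex.sel uminus_complex.sel Re_sum)
      thus ?thesis unfolding S11_def by (simp only: sum.distrib) simp
    qed
    ultimately show ?thesis by simp
  qed
  have N0: "M 0 = N" "M1 0 = 2 * Re (S1 * u)"
    unfolding M_def N_def M1_def S1_def by (simp_all add: mult.commute)
  show ?thesis
  proof (rule deriv_deriv_eqI[OF r])
    fix s :: real assume s: "\<bar>s\<bar> < r"
    have "((\<lambda>s. k * ln (M s)) has_real_derivative k * (M1 s / M s)) (at s)"
      using Mpos[OF s] by (auto intro!: derivative_eq_intros M s)
    moreover have "eventually (\<lambda>s. s \<in> {-r<..<r}) (nhds s)"
      using s by (intro eventually_nhds_in_open) auto
    hence "eventually (\<lambda>s. k * ln (M s) = phi (u * of_real s)) (nhds s)"
      by eventually_elim (auto simp: M_def intro!: phi[OF inb, symmetric])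
    ultimately show "((\<lambda>s. phi (u * of_real s)) has_real_derivative k * (M1 s / M s)) (at s)"
      by (subst DERIV_cong_ev[OF refl _ refl]) (auto elim: eventually_mono)
  next
    have "M 0 > 0" using Mpos r by simp
    thus "((\<lambda>s. k * (M1 s / M s)) has_real_derivative
       k * ((2 * Re (S2 * u\<^sup>2) + 2 * S11) / N - (2 * Re (S1 * u))\<^sup>2 / N\<^sup>2)) (at 0)"
      using DERIV_cmult[OF DERIV_divide[OF M1 M[of 0]], of k] r
      by (simp add: N0 diff_divide_distrib power2_eq_square)
  qed
qed

text \<open>On adding the directions 1 and \<i> the \<open>S2\<close> terms cancel, because
  \<open>u^2\<close> is 1 and -1, and the squares of \<open>Re S1\<close> and \<open>Im S1\<close>
  combine to the squared modulus.\<close>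

lemma laplacian_ln_hermitian:
  fixes P :: "'i::finite \<Rightarrow> complex \<Rightarrow> complex" and q :: "complex \<Rightarrow> complex"
    and phi :: "complex \<Rightarrow> real"
  assumes r: "r > 0" and holP: "\<And>i. P i holomorphic_on ball 0 r" and holq: "q holomorphic_on ball 0 r"
    and pos: "\<And>x. x \<in> ball 0 r \<Longrightarrow> 1 - (\<Sum>i\<in>UNIV. (cmod (P i x))\<^sup>2) + (cmod (q x))\<^sup>2 > 0"
    and phi: "\<And>x. x \<in> ball 0 r \<Longrightarrow> phi x = k * ln (1 - (\<Sum>i\<in>UNIV. (cmod (P i x))\<^sup>2) + (cmod (q x))\<^sup>2)"
  defines "N \<equiv> 1 - (\<Sum>i\<in>UNIV. (cmod (P i 0))\<^sup>2) + (cmod (q 0))\<^sup>2"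
    and "S1 \<equiv> - (\<Sum>i\<in>UNIV. deriv (P i) 0 * cnj (P i 0)) + deriv q 0 * cnj (q 0)"
    and "S11 \<equiv> - (\<Sum>i\<in>UNIV. (cmod (deriv (P i) 0))\<^sup>2) + (cmod (deriv q 0))\<^sup>2"
  shows "1/4 * (deriv (deriv (\<lambda>s. phi (of_real s))) 0 + deriv (deriv (\<lambda>t. phi (\<i> * of_real t))) 0)
    = k * (S11 / N - (cmod S1)\<^sup>2 / N\<^sup>2)"
proof -
  note * = deriv_deriv_ln_direction[OF r holP holq pos phi, folded N_def S1_def S11_def]
  have 1: "deriv (deriv (\<lambda>s. phi (of_real s))) 0 = k * ((2 * Re a + 2 * S11) / N - (2 * Re S1)\<^sup>2 / N\<^sup>2)"
    and 2: "deriv (deriv (\<lambda>t. phi (\<i> * of_real t))) 0 = k * ((- 2 * Re a + 2 * S11) / N - (2 * Im S1)\<^sup>2 / N\<^sup>2)"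
    if "a = - (\<Sum>i\<in>UNIV. deriv (deriv (P i)) 0 * cnj (P i 0)) + deriv (deriv q) 0 * cnj (q 0)" for a
    using *[of 1] *[of \<i>] unfolding that[symmetric] by simp_all
  show ?thesis unfolding 1[OF refl] 2[OF refl] cmod_power2
    by (simp add: add_divide_distrib diff_divide_distrib power_mult_distrib ring_distribs)
qed

section \<open>Generic norm and its Levi form\<close>

definition hprod :: "complex^'m \<Rightarrow> complex^'m \<Rightarrow> complex" where
  "hprod Z W = (\<Sum>i\<in>UNIV. Z $ i * cnj (W $ i))"

definition bprod :: "complex^'m \<Rightarrow> complex^'m \<Rightarrow> complex" where
  "bprod Z W = (\<Sum>i\<in>UNIV. Z $ i * W $ i)"

definition gen_norm :: "complex^'m \<Rightarrow> real" where
  "gen_norm Z = 1 - zzbar Z + 1/4 * (cmod (zzt Z))\<^sup>2"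

text \<open>The Levi form of \<open>ln gen_norm\<close> in the shape
  \<open>N11 / N - |N1|^2 / N^2\<close>: the first numerator is the mixed second derivative of
  \<open>gen_norm\<close> along \<open>w\<close>, and the modulus in the second term is taken of its
  complex first derivative.\<close>

definition levi_form :: "complex^'m \<Rightarrow> complex^'m \<Rightarrow> real" where
  "levi_form Z w = (- zzbar w + (cmod (bprod Z w))\<^sup>2) / gen_norm Z
     - (cmod (- hprod w Z + bprod Z w * cnj (zzt Z) / 2))\<^sup>2 / (gen_norm Z)\<^sup>2"

lemma typeIV_iff: "Z \<in> typeIV \<longleftrightarrow> zzbar Z < 2 \<and> gen_norm Z > 0"
  by (simp add: typeIV_def gen_norm_def)

lemma unit_ball_iff: "z \<in> unit_ball \<longleftrightarrow> zzbar z < 1"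
  by (simp add: unit_ball_def zzbar_def)

lemma hprod_self: "hprod Z Z = of_real (zzbar Z)"
  by (simp add: hprod_def zzbar_def flip: complex_norm_square)

lemma zzbar_nonneg [simp]: "zzbar Z \<ge> 0"
  by (simp add: zzbar_def sum_nonneg)

lemma zzt_smult: "zzt (c *s Z) = c\<^sup>2 * zzt Z"
  by (simp add: zzt_def sum_distrib_left power_mult_distrib)

lemma zzbar_smult: "zzbar (c *s Z) = (cmod c)\<^sup>2 * zzbar Z"
  by (simp add: zzbar_def norm_mult power_mult_distrib sum_distrib_left)

lemma zzbar_eq_0_iff: "zzbar Z = 0 \<longleftrightarrow> Z = 0"
  unfolding zzbar_def by (subst sum_nonneg_eq_0_iff) (auto simp: vec_eq_iff)

lemma hprod_add_left: "hprod (Z + W) Y = hprod Z Y + hprod W Y"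
  by (simp add: hprod_def algebra_simps sum.distrib)

lemma hprod_add_right: "hprod Y (Z + W) = hprod Y Z + hprod Y W"
  by (simp add: hprod_def algebra_simps sum.distrib)

lemma hprod_smult_left: "hprod (c *s Z) W = c * hprod Z W"
  by (simp add: hprod_def sum_distrib_left mult_ac)

lemma hprod_smult_right: "hprod Z (c *s W) = cnj c * hprod Z W"
  by (simp add: hprod_def sum_distrib_left mult_ac)

lemma cnj_hprod: "cnj (hprod Z W) = hprod W Z"
  by (simp add: hprod_def cnj_sum mult.commute)

lemma gen_norm_eq: "gen_norm Z = 1 - (\<Sum>i\<in>UNIV. (cmod (Z $ i))\<^sup>2) + (cmod (zzt Z / 2))\<^sup>2"
  by (simp add: gen_norm_def zzbar_def norm_divide power_divide)

lemma open_typeIV [simp]: "open (typeIV :: (complex^'m) set)"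
  unfolding typeIV_def zzbar_def zzt_def
  by (intro open_Collect_conj open_Collect_less continuous_intros)

lemma open_unit_ball [simp]: "open (unit_ball :: (complex^'m) set)"
  unfolding unit_ball_def
  by (intro open_Collect_less continuous_intros)

lemma has_field_derivative_slice:
  fixes F :: "complex^'a \<Rightarrow> complex^'b"
  assumes "(F has_derivative L) (at (z + x *s v))" "\<And>c v. L (c *s v) = c *s L v"
  shows "((\<lambda>x. F (z + x *s v) $ i) has_field_derivative L v $ i) (at x)"
proof -
  have "((\<lambda>x. z + x *s v) has_derivative (\<lambda>h. h *s v)) (at x)"
  proof -
    have "linear (\<lambda>h::complex. h *s v)"
      by (rule linearI) (simp_all add: vec_eq_iff algebra_simps)
    hence "((\<lambda>h. h *s v) has_derivative (\<lambda>h. h *s v)) (at x)"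
      by (intro bounded_linear_imp_has_derivative) (simp add: linear_conv_bounded_linear)
    thus ?thesis by (auto intro!: derivative_eq_intros)
  qed
  from has_derivative_compose[OF this assms(1)]
  have "((\<lambda>x. F (z + x *s v)) has_derivative (\<lambda>h. h *s L v)) (at x)"
    by (simp add: assms(2))
  from bounded_linear.has_derivative[OF bounded_linear_vec_nth this, of i]
  show ?thesis by (simp add: has_field_derivative_def mult.commute[of _ "L v $ i"])
qed

lemma holo_mapD:
  assumes "holo_map F S" "z \<in> S"
  shows "(F has_derivative frechet_derivative F (at z)) (at z)"
    "frechet_derivative F (at z) (c *s v) = c *s frechet_derivative F (at z) v"
  using assms unfolding holo_map_def by (metis frechet_derivative_at)+

lemma holo_map_slice:
  assumes "holo_map F S" "z + x *s v \<in> S"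
  shows "((\<lambda>x. F (z + x *s v) $ i) has_field_derivative (frechet_derivative F (at (z + x *s v)) v) $ i) (at x)"
  by (intro has_field_derivative_slice holo_mapD[OF assms])

lemma holo_map_line:
  assumes "holo_map F S" "\<And>x. x \<in> ball 0 \<rho> \<Longrightarrow> a + x *s b \<in> S"
  shows "(\<lambda>x. F (a + x *s b) $ i) holomorphic_on ball 0 \<rho>"
  using holo_map_slice[OF assms(1) assms(2)] by (subst holomorphic_on_open) blast+

lemma holo_map_line_zzt:
  assumes "holo_map F S" "\<And>x. x \<in> ball 0 \<rho> \<Longrightarrow> a + x *s b \<in> S"
  shows "(\<lambda>x. zzt (F (a + x *s b)) / 2) holomorphic_on ball 0 \<rho>"
  unfolding zzt_def by (intro holomorphic_intros holo_map_line[OF assms]) auto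

lemma has_field_derivative_zzt:
  assumes "\<And>i. ((\<lambda>x. c x $ i) has_field_derivative w $ i) (at x)"
  shows "((\<lambda>x. zzt (c x)) has_field_derivative 2 * bprod (c x) w) (at x)"
  unfolding zzt_def bprod_def
  by (rule derivative_eq_intros assms refl)+ (simp add: sum_distrib_left mult_ac)

text \<open>Chain rule for the Levi form along a holomorphic curve: second derivatives of
  \<open>c\<close> drop out, so only position and velocity remain. The curve is a straight line for
  the metric of the domain itself and the image of a line for a pulled back metric.\<close>

lemma laplacian_ln_gen_norm:
  fixes c :: "complex \<Rightarrow> complex^'m"
  assumes r: "r > 0" and hol: "\<And>i. (\<lambda>x. c x $ i) holomorphic_on ball 0 r"
    and c: "\<And>x. x \<in> ball 0 r \<Longrightarrow> gen_norm (c x) > 0"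
    and phi: "\<And>x. x \<in> ball 0 r \<Longrightarrow> phi x = k * ln (gen_norm (c x))"
    and w: "\<And>i. ((\<lambda>x. c x $ i) has_field_derivative w $ i) (at 0)"
  shows "1/4 * (deriv (deriv (\<lambda>s. phi (of_real s))) 0 + deriv (deriv (\<lambda>t. phi (\<i> * of_real t))) 0)
    = k * levi_form (c 0) w"
proof -
  have gn: "gen_norm (c x) = 1 - (\<Sum>i\<in>UNIV. (cmod (c x $ i))\<^sup>2) + (cmod (zzt (c x) / 2))\<^sup>2" for x
    by (rule gen_norm_eq)
  have holq: "(\<lambda>x. zzt (c x) / 2) holomorphic_on ball 0 r"
    unfolding zzt_def by (intro holomorphic_intros hol) simp
  have dP: "deriv (\<lambda>x. c x $ i) 0 = w $ i" for i
    by (rule DERIV_imp_deriv[OF w])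
  have dq: "deriv (\<lambda>x. zzt (c x) / 2) 0 = bprod (c 0) w"
    by (rule DERIV_imp_deriv) (use DERIV_cdivide[OF has_field_derivative_zzt[OF w], of 2] in simp)
  show ?thesis
    using laplacian_ln_hermitian[of r "\<lambda>i x. c x $ i" "\<lambda>x. zzt (c x) / 2" phi k, OF r hol holq] c phi
    unfolding gn levi_form_def dP dq by (simp add: zzbar_def hprod_def)
qed

lemma ball_subset_preimage_line:
  fixes Z w :: "complex^'m"
  assumes "open S" "Z \<in> S"
  obtains r where "r > 0" "\<And>x. x \<in> ball 0 r \<Longrightarrow> Z + x *s w \<in> S"
proof -
  have "continuous_on UNIV (\<lambda>x. Z + x *s w)"
    unfolding vector_scalar_mult_def by (intro continuous_intros continuous_on_vec_lambda)
  hence "open ((\<lambda>x. Z + x *s w) -` S)"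
    using assms(1) by (simp add: continuous_on_open_vimage)
  moreover have "0 \<in> (\<lambda>x. Z + x *s w) -` S" using assms(2) by simp
  ultimately obtain r where "r > 0" "ball 0 r \<subseteq> (\<lambda>x. Z + x *s w) -` S"
    using open_contains_ball by blast
  thus ?thesis using that by blast
qed

lemma levi_log_bergman_typeIV:
  fixes Z :: "complex^'m"
  assumes "Z \<in> typeIV"
  shows "levi log_bergman_typeIV Z w = - real CARD('m) * levi_form Z w"
proof -
  obtain r where r: "r > 0" "\<And>x. x \<in> ball 0 r \<Longrightarrow> Z + x *s w \<in> typeIV"
    using ball_subset_preimage_line[OF open_typeIV assms] by blast
  have l: "log_bergman_typeIV Y = - real CARD('m) * ln (gen_norm Y)" if "Y \<in> typeIV" for Y :: "complex^'m"
    using that unfolding log_bergman_typeIV_def gen_norm_def typeIV_iff by (simp add: ln_powr)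
  have "levi log_bergman_typeIV Z w = - real CARD('m) * levi_form (Z + 0 *s w) w"
    unfolding levi_def
  proof (rule laplacian_ln_gen_norm[OF r(1), where phi="\<lambda>x. log_bergman_typeIV (Z + x *s w)"])
    show "log_bergman_typeIV (Z + x *s w) = - real CARD('m) * ln (gen_norm (Z + x *s w))" if "x \<in> ball 0 r" for x
      by (rule l[OF r(2)[OF that]])
  qed (use r(2) in \<open>auto intro!: holomorphic_intros derivative_eq_intros simp: typeIV_iff\<close>)
  thus ?thesis by simp
qed

lemma levi_log_bergman_ball:
  fixes z :: "complex^'n"
  assumes "z \<in> unit_ball"
  shows "levi log_bergman_ball z v = real (CARD('n) + 1) * (zzbar v / (1 - zzbar z) + (cmod (hprod v z))\<^sup>2 / (1 - zzbar z)\<^sup>2)"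
proof -
  obtain r where r: "r > 0" "\<And>x. x \<in> ball 0 r \<Longrightarrow> z + x *s v \<in> unit_ball"
    using ball_subset_preimage_line[OF open_unit_ball assms] by blast
  have l: "log_bergman_ball y = - real (CARD('n) + 1) * ln (1 - (\<Sum>i\<in>UNIV. (cmod (y $ i))\<^sup>2))" if "y \<in> unit_ball" for y :: "complex^'n"
    using that unfolding log_bergman_ball_def unit_ball_def by (simp add: ln_powr)
  have d: "deriv (\<lambda>x. z $ i + x * v $ i) 0 = v $ i" for i
    by (rule DERIV_imp_deriv) (auto intro!: derivative_eq_intros)
  have "levi log_bergman_ball z v = - real (CARD('n) + 1) * (- zzbar v / (1 - zzbar z) - (cmod (hprod v z))\<^sup>2 / (1 - zzbar z)\<^sup>2)"
    using laplacian_ln_hermitian[of r "\<lambda>i x. z $ i + x * v $ i" "\<lambda>x. 0" "\<lambda>x. log_bergman_ball (z + x *s v)" "- real (CARD('n) + 1)", OF r(1)]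
      r(2)
    unfolding levi_def d by (simp add: unit_ball_def zzbar_def hprod_def holomorphic_intros l)
  thus ?thesis by (simp only: minus_divide_left[symmetric] ring_distribs minus_mult_minus minus_diff_eq)
qed

lemma isometry_levi_form:
  fixes F :: "complex^'n \<Rightarrow> complex^'m"
  assumes "holo_isometry F unit_ball log_bergman_ball typeIV log_bergman_typeIV"
  obtains \<mu> where "\<mu> > 0" "\<And>z v. z \<in> unit_ball \<Longrightarrow> levi_form (F z) (frechet_derivative F (at z) v)
     = - \<mu> * (zzbar v / (1 - zzbar z) + (cmod (hprod v z))\<^sup>2 / (1 - zzbar z)\<^sup>2)"
proof -
  from assms obtain lam where lam: "lam > 0" and F: "F ` unit_ball \<subseteq> typeIV"
    and eq: "\<And>z v. z \<in> unit_ball \<Longrightarrow> levi log_bergman_typeIV (F z) (frechet_derivative F (at z) v) = lam * levi log_bergman_ball z v"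
    unfolding holo_isometry_def by blast
  show ?thesis
  \<comment> \<open>The potentials are \<open>- (n + 1)\<close> and \<open>- m\<close> times
    logarithms of norms, so \<open>lam\<close> is rescaled by the quotient of these factors.\<close>
  proof (rule that[of "lam * real (CARD('n) + 1) / real CARD('m)"])
    fix z v :: "complex^'n" assume z: "z \<in> unit_ball"
    have "F z \<in> typeIV" using F z by blast
    from eq[OF z, of v] show "levi_form (F z) (frechet_derivative F (at z) v)
     = - (lam * real (CARD('n) + 1) / real CARD('m)) * (zzbar v / (1 - zzbar z) + (cmod (hprod v z))\<^sup>2 / (1 - zzbar z)\<^sup>2)"
      unfolding levi_log_bergman_ball[OF z] levi_log_bergman_typeIV[OF \<open>F z \<in> typeIV\<close>]
      by (simp add: field_simps)
  qed (use lam in simp)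
qed

text \<open>The converse passage, which certifies the map \<open>G\<close> of the theorem: on the
  ball \<open>log_bergman_ball\<close> is \<open>- (n + 1)\<close> times
  \<open>ln (gen_norm (G z))\<close>, so both Levi forms can be computed along the image of a line
  under \<open>G\<close>.\<close>

lemma isometryI_gen_norm:
  fixes G :: "complex^'n \<Rightarrow> complex^'m"
  assumes hol: "holo_map G unit_ball" and sub: "G ` unit_ball \<subseteq> typeIV"
    and eq: "\<And>z. z \<in> unit_ball \<Longrightarrow> gen_norm (G z) = 1 - zzbar z"
  shows "holo_isometry G unit_ball log_bergman_ball typeIV log_bergman_typeIV"
  unfolding holo_isometry_def
proof (intro conjI hol sub exI[of _ "real CARD('m) / real (CARD('n) + 1)"] ballI allI)
  fix z v :: "complex^'n" assume z: "z \<in> unit_ball"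
  obtain r where r: "r > 0" "\<And>x. x \<in> ball 0 r \<Longrightarrow> z + x *s v \<in> unit_ball"
    using ball_subset_preimage_line[OF open_unit_ball z] by blast
  have l: "log_bergman_ball y = - real (CARD('n) + 1) * ln (gen_norm (G y))" if "y \<in> unit_ball" for y :: "complex^'n"
    using that unfolding log_bergman_ball_def eq[OF that] zzbar_def[symmetric] unit_ball_iff by (simp add: ln_powr)
  have "levi log_bergman_ball z v = - real (CARD('n) + 1) * levi_form (G (z + 0 *s v)) (frechet_derivative G (at z) v)"
    unfolding levi_def
  proof (rule laplacian_ln_gen_norm[OF r(1), where phi="\<lambda>x. log_bergman_ball (z + x *s v)"])
    show "(\<lambda>x. G (z + x *s v) $ i) holomorphic_on ball 0 r" for i
      by (rule holo_map_line[OF hol r(2)])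
    show "((\<lambda>x. G (z + x *s v) $ i) has_field_derivative frechet_derivative G (at z) v $ i) (at 0)" for i
      using holo_map_slice[OF hol, of z 0 v i] z by simp
  qed (use r(2) in \<open>auto simp: l eq unit_ball_iff\<close>)
  moreover have "G z \<in> typeIV" using sub z by blast
  ultimately show "levi log_bergman_typeIV (G z) (frechet_derivative G (at z) v) = 
    real CARD('m) / real (CARD('n) + 1) * levi log_bergman_ball z v"
    by (simp add: levi_log_bergman_typeIV divide_simps del: of_nat_add) (simp add: algebra_simps)
qed simp

subsection \<open>Potentials on the disc\<close>

text \<open>The numbers \<open>a\<close> and \<open>b\<close> are the Wirtinger derivatives with
  respect to the variable and its conjugate. The equation \<open>b = 0\<close> is the Cauchy-Riemann
  equation, so holomorphy can be read off from the calculus rules below.\<close>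

definition has_wirtinger :: "(complex \<Rightarrow> complex) \<Rightarrow> complex \<Rightarrow> complex \<Rightarrow> complex \<Rightarrow> bool" where
  "has_wirtinger f a b x \<longleftrightarrow> (f has_derivative (\<lambda>h. a * h + b * cnj h)) (at x)"

lemma wirtinger_holomorphic: "(f has_field_derivative f') (at x) \<Longrightarrow> has_wirtinger f f' 0 x"
  unfolding has_wirtinger_def has_field_derivative_def by simp

lemma wirtinger_cnj: "has_wirtinger f a b x \<Longrightarrow> has_wirtinger (\<lambda>x. cnj (f x)) (cnj b) (cnj a) x"
  unfolding has_wirtinger_def
  by (drule bounded_linear.has_derivative[OF bounded_linear_cnj]) (simp add: add.commute)

lemma wirtinger_const: "has_wirtinger (\<lambda>x. k) 0 0 x"
  unfolding has_wirtinger_def by simp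

lemma wirtinger_add: "has_wirtinger f a b x \<Longrightarrow> has_wirtinger g a' b' x \<Longrightarrow> has_wirtinger (\<lambda>x. f x + g x) (a + a') (b + b') x"
  unfolding has_wirtinger_def by (drule (1) has_derivative_add) (simp add: algebra_simps)

lemma wirtinger_diff: "has_wirtinger f a b x \<Longrightarrow> has_wirtinger g a' b' x \<Longrightarrow> has_wirtinger (\<lambda>x. f x - g x) (a - a') (b - b') x"
  unfolding has_wirtinger_def by (drule (1) has_derivative_diff) (simp add: algebra_simps)

lemma wirtinger_mult:
  "has_wirtinger f a b x \<Longrightarrow> has_wirtinger g a' b' x \<Longrightarrow>
   has_wirtinger (\<lambda>x. f x * g x) (f x * a' + a * g x) (f x * b' + b * g x) x"
  unfolding has_wirtinger_def by (drule (1) has_derivative_mult) (simp add: algebra_simps)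

lemma wirtinger_divide:
  "has_wirtinger f a b x \<Longrightarrow> has_wirtinger g a' b' x \<Longrightarrow> g x \<noteq> 0 \<Longrightarrow>
   has_wirtinger (\<lambda>x. f x / g x) ((a * g x - f x * a') / (g x * g x)) ((b * g x - f x * b') / (g x * g x)) x"
  unfolding has_wirtinger_def
  by (drule (2) has_derivative_divide', erule has_derivative_eq_rhs)
    (auto simp: ring_distribs add_divide_distrib diff_divide_distrib mult_ac)

lemma wirtinger_sum:
  "(\<And>i. i \<in> I \<Longrightarrow> has_wirtinger (f i) (a i) (b i) x) \<Longrightarrow>
   has_wirtinger (\<lambda>x. \<Sum>i\<in>I. f i x) (\<Sum>i\<in>I. a i) (\<Sum>i\<in>I. b i) x"
  by (induction I rule: infinite_finite_induct) (simp_all add: wirtinger_const wirtinger_add)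

text \<open>Taking \<open>cnj a\<close> as second coefficient makes the differential real: it is
  \<open>2 * Re (a * h)\<close>.\<close>

lemma has_derivative_ln_wirtinger:
  assumes "has_wirtinger f a (cnj a) x" "Re (f x) > 0"
  shows "((\<lambda>x. ln (Re (f x))) has_derivative (\<lambda>h. 2 * Re (a * h) / Re (f x))) (at x)"
proof -
  have e: "Re (a * h + cnj a * cnj h) = 2 * Re (a * h)" for h
    by simp
  from bounded_linear.has_derivative[OF bounded_linear_Re assms(1)[unfolded has_wirtinger_def]]
  have "((\<lambda>x. Re (f x)) has_derivative (\<lambda>h. 2 * Re (a * h))) (at x)" unfolding e .
  from has_derivative_ln[OF assms(2) this] show ?thesis by (simp add: divide_inverse mult_ac)
qed

text \<open>The metric equation says that \<open>ln N - \<mu> ln M\<close> is harmonic, with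
  \<open>M\<close> the norm \<open>1 - |x|^2\<close> of the disc. On a disc a real harmonic function
  is the real part of a holomorphic one, and exponentiating gives the factor
  \<open>exp h\<close>.\<close>

lemma disc_potential:
  fixes P :: "'i::finite \<Rightarrow> complex \<Rightarrow> complex" and q :: "complex \<Rightarrow> complex"
  assumes holP: "\<And>i. P i holomorphic_on ball 0 1" and holq: "q holomorphic_on ball 0 1"
    and pos: "\<And>x. x \<in> ball 0 1 \<Longrightarrow> 1 - (\<Sum>i\<in>UNIV. (cmod (P i x))\<^sup>2) + (cmod (q x))\<^sup>2 > 0"
    and eq: "\<And>x. x \<in> ball 0 1 \<Longrightarrow>
      (- (\<Sum>i\<in>UNIV. (cmod (deriv (P i) x))\<^sup>2) + (cmod (deriv q x))\<^sup>2) / (1 - (\<Sum>i\<in>UNIV. (cmod (P i x))\<^sup>2) + (cmod (q x))\<^sup>2)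
      - (cmod (- (\<Sum>i\<in>UNIV. deriv (P i) x * cnj (P i x)) + deriv q x * cnj (q x)))\<^sup>2
         / (1 - (\<Sum>i\<in>UNIV. (cmod (P i x))\<^sup>2) + (cmod (q x))\<^sup>2)\<^sup>2
      = - \<mu> / (1 - (cmod x)\<^sup>2)\<^sup>2"
  obtains h where "h holomorphic_on ball 0 1"
    "\<And>x. x \<in> ball 0 1 \<Longrightarrow> 1 - (\<Sum>i\<in>UNIV. (cmod (P i x))\<^sup>2) + (cmod (q x))\<^sup>2 = (cmod (exp (h x)))\<^sup>2 * (1 - (cmod x)\<^sup>2) powr \<mu>"
proof -
  define N where "N = (\<lambda>x. 1 - (\<Sum>i\<in>UNIV. P i x * cnj (P i x)) + q x * cnj (q x))"
  define S1 where "S1 = (\<lambda>x. 0 - (\<Sum>i\<in>UNIV. deriv (P i) x * cnj (P i x)) + deriv q x * cnj (q x))"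
  define S2 where "S2 = (\<lambda>x. 0 - (\<Sum>i\<in>UNIV. deriv (deriv (P i)) x * cnj (P i x)) + deriv (deriv q) x * cnj (q x))"
  define S11 where "S11 = (\<lambda>x. 0 - (\<Sum>i\<in>UNIV. deriv (P i) x * cnj (deriv (P i) x)) + deriv q x * cnj (deriv q x))"
  define M where "M = (\<lambda>x::complex. 1 - x * cnj x)"
  \<comment> \<open>This is the Wirtinger derivative of \<open>ln N - \<mu> ln M\<close> in
    \<open>x\<close>; the hypothesis \<open>eq\<close> says exactly that its conjugate derivative
    vanishes.\<close>
  define p where "p = (\<lambda>x. S1 x / N x + of_real \<mu> * cnj x / M x)"
  have N_real: "N x = of_real (1 - (\<Sum>i\<in>UNIV. (cmod (P i x))\<^sup>2) + (cmod (q x))\<^sup>2)" for x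
    unfolding N_def by (simp add: complex_norm_square del: of_real_power)
  have M_real: "M x = of_real (1 - (cmod x)\<^sup>2)" for x
    unfolding M_def by (simp add: complex_norm_square del: of_real_power)
  have S11_real: "S11 x = of_real (- (\<Sum>i\<in>UNIV. (cmod (deriv (P i) x))\<^sup>2) + (cmod (deriv q x))\<^sup>2)" for x
    unfolding S11_def by (simp add: complex_norm_square del: of_real_power)
  have Mpos: "1 - (cmod x)\<^sup>2 > 0" if "x \<in> ball 0 1" for x :: complex
    using that by (simp add: power_less_one_iff abs_square_less_1)
  have RN: "Re (N x) > 0" if "x \<in> ball 0 1" for x unfolding N_real using pos[OF that] by simp
  have RM: "Re (M x) > 0" if "x \<in> ball 0 1" for x unfolding M_real using Mpos[OF that] by simp
  have N0: "N x \<noteq> 0" and M0: "M x \<noteq> 0" if "x \<in> ball 0 1" for x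
    using RN[OF that] RM[OF that] by auto
  have wf: "has_wirtinger f (deriv f x) 0 x" "has_wirtinger (deriv f) (deriv (deriv f) x) 0 x"
    if "f holomorphic_on ball 0 1" "x \<in> ball 0 1" for f x
    using that by (auto intro!: wirtinger_holomorphic holomorphic_derivI[of _ "ball 0 1"] holomorphic_deriv)
  have wN: "has_wirtinger N (S1 x) (cnj (S1 x)) x" if "x \<in> ball 0 1" for x
  proof -
    have "has_wirtinger (\<lambda>x. f x * cnj (f x)) (deriv f x * cnj (f x)) (f x * cnj (deriv f x)) x" if f: "f holomorphic_on ball 0 1" for f
      using wirtinger_mult[OF wf(1)[OF f \<open>x \<in> _\<close>] wirtinger_cnj[OF wf(1)[OF f \<open>x \<in> _\<close>]]] by simp
    note * = this
    have "has_wirtinger N (S1 x) (0 - (\<Sum>i\<in>UNIV. P i x * cnj (deriv (P i) x)) + q x * cnj (deriv q x)) x"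
      unfolding N_def S1_def by (intro wirtinger_add wirtinger_diff wirtinger_const wirtinger_sum * holP holq)
    also have "0 - (\<Sum>i\<in>UNIV. P i x * cnj (deriv (P i) x)) + q x * cnj (deriv q x) = cnj (S1 x)"
      unfolding S1_def by (simp add: cnj_sum mult.commute)
    finally show ?thesis .
  qed
  have wS1: "has_wirtinger S1 (S2 x) (S11 x) x" if "x \<in> ball 0 1" for x
  proof -
    have "has_wirtinger (\<lambda>x. deriv f x * cnj (f x)) (deriv (deriv f) x * cnj (f x)) (deriv f x * cnj (deriv f x)) x" if f: "f holomorphic_on ball 0 1" for f
      using wirtinger_mult[OF wf(2)[OF f \<open>x \<in> _\<close>] wirtinger_cnj[OF wf(1)[OF f \<open>x \<in> _\<close>]]] by simp
    note * = this
    show ?thesis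
      unfolding S1_def S2_def S11_def by (intro wirtinger_add wirtinger_diff wirtinger_const wirtinger_sum * holP holq)
  qed
  have wid: "has_wirtinger (\<lambda>x. x) 1 0 x" for x unfolding has_wirtinger_def by simp
  have wcn: "has_wirtinger cnj 0 1 x" for x using wirtinger_cnj[OF wid] by simp
  have wM: "has_wirtinger M (- cnj x) (- x) x" for x
    using wirtinger_diff[OF wirtinger_const[of 1] wirtinger_mult[OF wid wcn]] unfolding M_def by simp
  have p_deriv: "\<exists>p'. (p has_field_derivative p') (at x)" if x: "x \<in> ball 0 1" for x
  proof -
    have "has_wirtinger p
       ((S2 x * N x - S1 x * S1 x) / (N x * N x) + (0 * M x - of_real \<mu> * cnj x * - cnj x) / (M x * M x))
       ((S11 x * N x - S1 x * cnj (S1 x)) / (N x * N x) + (of_real \<mu> * M x - of_real \<mu> * cnj x * - x) / (M x * M x)) x"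
      unfolding p_def
      using wirtinger_add[OF wirtinger_divide[OF wS1[OF x] wN[OF x] N0[OF x]]
          wirtinger_divide[OF wirtinger_mult[OF wirtinger_const[of "of_real \<mu>"] wcn] wM M0[OF x]]] by simp
    also have "(S11 x * N x - S1 x * cnj (S1 x)) / (N x * N x) + (of_real \<mu> * M x - of_real \<mu> * cnj x * - x) / (M x * M x) = 0"
    proof -
      have "(S11 x * N x - S1 x * cnj (S1 x)) / (N x * N x) = S11 x / N x - S1 x * cnj (S1 x) / (N x)\<^sup>2"
        using N0[OF x] by (simp add: diff_divide_distrib power2_eq_square)
      also have "\<dots> = of_real (- \<mu> / (1 - (cmod x)\<^sup>2)\<^sup>2)"
      proof -
        have s1: "S1 x * cnj (S1 x) = of_real ((cmod (- (\<Sum>i\<in>UNIV. deriv (P i) x * cnj (P i x)) + deriv q x * cnj (q x)))\<^sup>2)"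
          unfolding S1_def complex_norm_square by simp
        show ?thesis unfolding s1 S11_real N_real eq[OF x, symmetric] by simp
      qed
      also have "\<dots> = - of_real \<mu> / (M x * M x)" unfolding M_real by (simp add: power2_eq_square)
      also have "of_real \<mu> * M x - of_real \<mu> * cnj x * - x = of_real \<mu>" unfolding M_def by (simp add: algebra_simps)
      ultimately show ?thesis by simp
    qed
    finally show ?thesis unfolding has_wirtinger_def has_field_derivative_def by auto
  qed
  hence "p holomorphic_on ball 0 1" by (subst holomorphic_on_open) auto
  then obtain g where g: "\<And>x. x \<in> ball 0 1 \<Longrightarrow> (g has_field_derivative p x) (at x)"
    using holomorphic_convex_primitive'[of "ball 0 1" p] by (auto simp: at_within_open[OF _ open_ball])
  \<comment> \<open>The differential of the real function \<open>ln N - \<mu> ln M\<close> is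
    \<open>2 * Re (p x * h)\<close>, which is also that of \<open>2 * Re g\<close>; hence
    \<open>T\<close> is constant.\<close>
  define T where "T = (\<lambda>x. ln (Re (N x)) - 2 * Re (g x) - \<mu> * ln (Re (M x)))"
  have T: "(T has_derivative (\<lambda>h. 0)) (at x)" if x: "x \<in> ball 0 1" for x
  proof -
    have a: "((\<lambda>x. ln (Re (N x))) has_derivative (\<lambda>h. 2 * Re (S1 x * h) / Re (N x))) (at x)"
      by (rule has_derivative_ln_wirtinger[OF wN[OF x] RN[OF x]])
    have b: "((\<lambda>x. ln (Re (M x))) has_derivative (\<lambda>h. 2 * Re (- cnj x * h) / Re (M x))) (at x)"
    proof -
      have "has_wirtinger M (- cnj x) (cnj (- cnj x)) x" using wM[of x] by simp
      from has_derivative_ln_wirtinger[OF this RM[OF x]] show ?thesis .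
    qed
    have c: "((\<lambda>x. Re (g x)) has_derivative (\<lambda>h. Re (p x * h))) (at x)"
      using bounded_linear.has_derivative[OF bounded_linear_Re g[OF x, unfolded has_field_derivative_def]] .
    have "(T has_derivative (\<lambda>h. 2 * Re (S1 x * h) / Re (N x) - 2 * Re (p x * h) - \<mu> * (2 * Re (- cnj x * h) / Re (M x)))) (at x)"
      unfolding T_def by (intro has_derivative_diff has_derivative_mult_right a b c)
    moreover have "2 * Re (S1 x * h) / Re (N x) - 2 * Re (p x * h) - \<mu> * (2 * Re (- cnj x * h) / Re (M x)) = 0" for h
    proof -
      have 1: "N x = of_real (Re (N x))" "M x = of_real (Re (M x))" unfolding N_real M_real by simp_all
      have "p x * h = S1 x * h / of_real (Re (N x)) + of_real \<mu> * (cnj x * h) / of_real (Re (M x))"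
        unfolding p_def 1[symmetric] by (simp add: ring_distribs)
      hence "Re (p x * h) = Re (S1 x * h) / Re (N x) + \<mu> * Re (cnj x * h) / Re (M x)"
        by (simp only: plus_complex.sel Re_divide_of_real) simp
      moreover have "Re (- cnj x * h) = - Re (cnj x * h)" by simp
      moreover have "2 * A / n - 2 * (A / n + \<mu> * B / m) - \<mu> * (2 * (- B) / m) = 0" for A B n m :: real
        by simp
      ultimately show ?thesis by (simp only:)
    qed
    ultimately show ?thesis by simp
  qed
  have "\<exists>c. \<forall>x\<in>ball 0 1. T x = c"
    by (rule has_derivative_zero_constant) (auto intro: has_derivative_at_withinI[OF T])
  then obtain c where c: "\<And>x. x \<in> ball 0 1 \<Longrightarrow> T x = c" by blast
  show ?thesis
  \<comment> \<open>The constant is halved because the squared modulus of \<open>exp\<close> doubles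
    the real part.\<close>
  proof (rule that[of "\<lambda>x. g x + of_real (c / 2)"])
    show "(\<lambda>x. g x + of_real (c / 2)) holomorphic_on ball 0 1"
    proof (intro holomorphic_intros)
      show "g holomorphic_on ball 0 1" using g by (subst holomorphic_on_open) blast+
    qed
    fix x :: complex assume x: "x \<in> ball 0 1"
    have "ln (Re (N x)) = 2 * Re (g x + of_real (c / 2)) + \<mu> * ln (Re (M x))"
      using c[OF x] unfolding T_def by simp
    hence "Re (N x) = exp (2 * Re (g x + of_real (c / 2)) + \<mu> * ln (Re (M x)))"
      using RN[OF x] by (metis exp_ln)
    also have "\<dots> = (cmod (exp (g x + of_real (c / 2))))\<^sup>2 * (Re (M x)) powr \<mu>"
      using RM[OF x] unfolding norm_exp_eq_Re powr_def exp_add by (simp add: power2_eq_square flip: exp_add)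
    finally show "1 - (\<Sum>i\<in>UNIV. (cmod (P i x))\<^sup>2) + (cmod (q x))\<^sup>2 = (cmod (exp (g x + of_real (c / 2))))\<^sup>2 * (1 - (cmod x)\<^sup>2) powr \<mu>"
      unfolding N_real M_real Re_complex_of_real .
  qed
qed

subsection \<open>Polarization\<close>

text \<open>Holomorphy in two variables is tested on pairs of functions of one variable. This
  suffices for the substitution in \<open>polarization_disc\<close> and passes through sums and
  products at once.\<close>

definition joint_holo :: "(complex \<Rightarrow> complex \<Rightarrow> complex) \<Rightarrow> real \<Rightarrow> bool" where
  "joint_holo H \<rho> \<longleftrightarrow> (\<forall>f g S. open S \<longrightarrow> f holomorphic_on S \<longrightarrow> g holomorphic_on S \<longrightarrow> f ` S \<subseteq> ball 0 \<rho> \<longrightarrow> g ` S \<subseteq> ball 0 \<rho>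
     \<longrightarrow> (\<lambda>x. H (f x) (g x)) holomorphic_on S)"

lemma joint_holoI:
  "(\<And>f g S. open S \<Longrightarrow> f holomorphic_on S \<Longrightarrow> g holomorphic_on S \<Longrightarrow> f ` S \<subseteq> ball 0 \<rho> \<Longrightarrow> g ` S \<subseteq> ball 0 \<rho>
     \<Longrightarrow> (\<lambda>x. H (f x) (g x)) holomorphic_on S) \<Longrightarrow> joint_holo H \<rho>"
  unfolding joint_holo_def by simp

lemma joint_holoD:
  "joint_holo H \<rho> \<Longrightarrow> open S \<Longrightarrow> f holomorphic_on S \<Longrightarrow> g holomorphic_on S \<Longrightarrow> f ` S \<subseteq> ball 0 \<rho> \<Longrightarrow> g ` S \<subseteq> ball 0 \<rho>
     \<Longrightarrow> (\<lambda>x. H (f x) (g x)) holomorphic_on S"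
  unfolding joint_holo_def by simp

lemma joint_holo_const: "joint_holo (\<lambda>x y. c) \<rho>"
  by (rule joint_holoI) simp

lemma joint_holo_add: "joint_holo F \<rho> \<Longrightarrow> joint_holo G \<rho> \<Longrightarrow> joint_holo (\<lambda>x y. F x y + G x y) \<rho>"
  by (intro joint_holoI holomorphic_on_add) (rule joint_holoD; assumption)+

lemma joint_holo_diff: "joint_holo F \<rho> \<Longrightarrow> joint_holo G \<rho> \<Longrightarrow> joint_holo (\<lambda>x y. F x y - G x y) \<rho>"
  by (intro joint_holoI holomorphic_on_diff) (rule joint_holoD; assumption)+

lemma joint_holo_mult: "joint_holo F \<rho> \<Longrightarrow> joint_holo G \<rho> \<Longrightarrow> joint_holo (\<lambda>x y. F x y * G x y) \<rho>"
  by (intro joint_holoI holomorphic_on_mult) (rule joint_holoD; assumption)+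

lemma joint_holo_sum: "(\<And>i. i \<in> I \<Longrightarrow> joint_holo (F i) \<rho>) \<Longrightarrow> joint_holo (\<lambda>x y. \<Sum>i\<in>I. F i x y) \<rho>"
  by (induction I rule: infinite_finite_induct) (simp_all add: joint_holo_const joint_holo_add)

lemma joint_holo_fst: "f holomorphic_on ball 0 \<rho> \<Longrightarrow> joint_holo (\<lambda>x y. f x) \<rho>"
  by (rule joint_holoI) (rule holomorphic_on_compose_gen[unfolded o_def, of _ _ f "ball 0 \<rho>"])

text \<open>On the antidiagonal \<open>y = cnj x\<close> this function is \<open>cnj (f x)\<close>,
  so it extends an antiholomorphic factor holomorphically in the second variable.\<close>

lemma joint_holo_snd_cnj:
  assumes "f holomorphic_on ball 0 \<rho>"
  shows "joint_holo (\<lambda>x y. cnj (f (cnj y))) \<rho>"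
proof -
  have im: "cnj ` ball 0 \<rho> = ball 0 \<rho>"
  proof
    show "ball 0 \<rho> \<subseteq> cnj ` ball 0 \<rho>"
    proof
      fix x assume "x \<in> ball (0::complex) \<rho>"
      thus "x \<in> cnj ` ball 0 \<rho>" by (intro image_eqI[of _ _ "cnj x"]) auto
    qed
  qed auto
  have "(\<lambda>y. cnj (f (cnj y))) holomorphic_on ball 0 \<rho>"
    using holomorphic_on_compose_cnj_cnj[of f "ball 0 \<rho>"] assms im by (simp add: o_def)
  thus ?thesis
    by (intro joint_holoI) (rule holomorphic_on_compose_gen[unfolded o_def, of _ _ "\<lambda>y. cnj (f (cnj y))" "ball 0 \<rho>"])
qed

text \<open>The product of two points of the disc has modulus below \<open>\<rho>^2 \<le> a\<close>,
  so the base stays in the right half plane, off the branch cut.\<close>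

lemma joint_holo_powr:
  assumes "a \<ge> \<rho>\<^sup>2" "\<rho> > 0"
  shows "joint_holo (\<lambda>x y. (of_real a - x * y) powr c) \<rho>"
proof (rule joint_holoI)
  fix f g S assume *: "open S" "f holomorphic_on S" "g holomorphic_on S" "f ` S \<subseteq> ball 0 \<rho>" "g ` S \<subseteq> ball 0 \<rho>"
  have "of_real a - f x * g x \<notin> \<real>\<^sub>\<le>\<^sub>0" if "x \<in> S" for x
  proof -
    have "cmod (f x) < \<rho>" "cmod (g x) < \<rho>" using *(4,5) that by auto
    hence "cmod (f x * g x) < \<rho> * \<rho>" unfolding norm_mult by (intro mult_strict_mono') auto
    hence "Re (f x * g x) < a" using complex_Re_le_cmod[of "f x * g x"] assms(1) by (simp add: power2_eq_square)
    thus ?thesis by (auto simp: complex_nonpos_Reals_iff)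
  qed
  thus "(\<lambda>x. (of_real a - f x * g x) powr c) holomorphic_on S"
    by (intro holomorphic_intros *) auto
qed

lemma holomorphic_vanish_real:
  assumes f: "f holomorphic_on S" and S: "open S" "convex S" "0 \<in> S"
    and zero: "\<And>t. of_real t \<in> S \<Longrightarrow> f (of_real t) = 0" and w: "w \<in> S"
  shows "f w = 0"
proof (rule analytic_continuation[OF f S(1) _ _ S(3) _ _ w])
  show "connected S" using S(2) by (rule convex_connected)
  show "S \<inter> range of_real \<subseteq> S" by blast
  show "f z = 0" if "z \<in> S \<inter> range of_real" for z using that zero by auto
  show "0 islimpt S \<inter> range of_real"
    unfolding islimpt_approachable
  proof (intro allI impI)
    fix e :: real assume e: "e > 0"
    obtain d where d: "d > 0" "ball 0 d \<subseteq> S" using S open_contains_ball by blast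
    define t where "t = min e d / 2"
    have "t > 0" "t < e" "t < d" unfolding t_def using e d(1) by auto
    thus "\<exists>x'\<in>S \<inter> range complex_of_real. x' \<noteq> 0 \<and> dist x' 0 < e"
      using d(2) by (intro bexI[of _ "of_real t"]) (auto simp: subset_iff)
  qed
qed

text \<open>Writing the two variables as \<open>u + \<i> v\<close> and \<open>u - \<i> v\<close>, the hypothesis says that \<open>H\<close> vanishes
  for real \<open>u\<close>, \<open>v\<close>; the identity theorem is applied first in \<open>u\<close> and then in \<open>v\<close>.\<close>
lemma polarization_disc:
  assumes H: "joint_holo H \<rho>" and diag: "\<And>x. x \<in> ball 0 \<rho> \<Longrightarrow> H x (cnj x) = 0"
    and x: "x \<in> ball 0 \<rho>" and y: "y \<in> ball 0 \<rho>"
  shows "H x y = 0"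
proof -
  have sum2: "cmod (2 * a) \<le> cmod (a + b) + cmod (a - b)" for a b :: complex
    using norm_triangle_ineq[of "a + b" "a - b"] by simp
  have step1: "H (u + \<i> * of_real t) (u - \<i> * of_real t) = 0"
    if u: "u + \<i> * of_real t \<in> ball 0 \<rho>" "u - \<i> * of_real t \<in> ball 0 \<rho>" for u t
  proof -
    define S where "S = {u. u + \<i> * of_real t \<in> ball 0 \<rho>} \<inter> {u. u - \<i> * of_real t \<in> ball 0 \<rho>}"
    have S: "S = ball (- \<i> * of_real t) \<rho> \<inter> ball (\<i> * of_real t) \<rho>"
    proof -
      have "cmod (u + \<i> * of_real t) = dist (- \<i> * of_real t) u" "cmod (u - \<i> * of_real t) = dist (\<i> * of_real t) u" for u
        unfolding dist_commute[of _ u] by (simp_all add: dist_norm)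
      thus ?thesis unfolding S_def by auto
    qed
    \<comment> \<open>The identity theorem is anchored at 0, so 0 has to be an admissible value of
      \<open>u\<close>: both shifts \<open>\<i> t\<close> and \<open>- \<i> t\<close> must have
      modulus below \<rho>, which \<open>sum2\<close> provides.\<close>
    have "cmod (2 * (\<i> * of_real t)) < 2 * \<rho>"
      using sum2[of "\<i> * of_real t" u] u by (simp add: add.commute norm_minus_commute)
    hence 0: "0 \<in> S" unfolding S_def by (simp add: norm_mult)
    show ?thesis
    proof (rule holomorphic_vanish_real[of "\<lambda>u. H (u + \<i> * of_real t) (u - \<i> * of_real t)" S u])
      show "open S" "convex S" unfolding S by (auto intro: convex_Int)
      show "(\<lambda>u. H (u + \<i> * of_real t) (u - \<i> * of_real t)) holomorphic_on S"
        by (rule joint_holoD[OF H])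
          (use \<open>open S\<close> in \<open>auto intro!: holomorphic_intros simp: S_def\<close>)
      show "H (of_real v + \<i> * of_real t) (of_real v - \<i> * of_real t) = 0" if "of_real v \<in> S" for v
        using diag[of "of_real v + \<i> * of_real t"] that unfolding S_def by simp
    qed (use 0 u in \<open>auto simp: S_def\<close>)
  qed
  define u where "u = (x + y) / 2"
  define v where "v = (x - y) / (2 * \<i>)"
  have xy: "x = u + \<i> * v" "y = u - \<i> * v" unfolding u_def v_def by (simp_all add: field_simps)
  define S where "S = {v. u + \<i> * v \<in> ball 0 \<rho>} \<inter> {v. u - \<i> * v \<in> ball 0 \<rho>}"
  have S: "S = ball (\<i> * u) \<rho> \<inter> ball (- \<i> * u) \<rho>"
  proof -
    have "cmod (u + \<i> * v) = dist (\<i> * u) v" "cmod (u - \<i> * v) = dist (- \<i> * u) v" for v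
    proof -
      have "\<i> * (u + \<i> * v) = \<i> * u - v" "- \<i> * (u - \<i> * v) = - \<i> * u - v" by (simp_all add: algebra_simps)
      hence "cmod (\<i> * u - v) = cmod (\<i> * (u + \<i> * v))" "cmod (- \<i> * u - v) = cmod (- \<i> * (u - \<i> * v))" by metis+
      thus "cmod (u + \<i> * v) = dist (\<i> * u) v" "cmod (u - \<i> * v) = dist (- \<i> * u) v"
        unfolding dist_norm by (simp_all add: norm_mult)
    qed
    thus ?thesis unfolding S_def by auto
  qed
  have "2 * u = x + y" unfolding u_def by simp
  hence "cmod (2 * u) < 2 * \<rho>" using norm_triangle_ineq[of x y] x y by simp
  hence 0: "0 \<in> S" unfolding S_def by (simp add: norm_mult)
  have "H (u + \<i> * v) (u - \<i> * v) = 0"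
  proof (rule holomorphic_vanish_real[of "\<lambda>v. H (u + \<i> * v) (u - \<i> * v)" S v])
    show "open S" "convex S" unfolding S by (auto intro: convex_Int)
    show "(\<lambda>v. H (u + \<i> * v) (u - \<i> * v)) holomorphic_on S"
      by (rule joint_holoD[OF H])
        (use \<open>open S\<close> in \<open>auto intro!: holomorphic_intros simp: S_def\<close>)
    show "H (u + \<i> * of_real t) (u - \<i> * of_real t) = 0" if "of_real t \<in> S" for t
      using step1[of u t] that unfolding S_def by simp
    show "v \<in> S" using x y unfolding S_def xy by simp
  qed (use 0 in simp)
  thus ?thesis unfolding xy .
qed

text \<open>Radius and constant \<open>a\<close> are left free because a complex line that misses
  the centre meets the ball in a disc of radius less than 1. The factor \<open>g\<close>
  accommodates the \<open>exp h\<close> of \<open>disc_potential\<close>.\<close>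

lemma polarized_norm_identity:
  fixes P :: "'i::finite \<Rightarrow> complex \<Rightarrow> complex"
  assumes \<rho>: "\<rho> > 0" "\<rho>\<^sup>2 \<le> a"
    and hol: "\<And>i. P i holomorphic_on ball 0 \<rho>" "q holomorphic_on ball 0 \<rho>" "g holomorphic_on ball 0 \<rho>"
    and eq: "\<And>x. x \<in> ball 0 \<rho> \<Longrightarrow> 1 - (\<Sum>i\<in>UNIV. (cmod (P i x))\<^sup>2) + (cmod (q x))\<^sup>2 = (cmod (g x))\<^sup>2 * (a - (cmod x)\<^sup>2) powr \<mu>"
    and x: "x \<in> ball 0 \<rho>" and y: "y \<in> ball 0 \<rho>"
  shows "1 - (\<Sum>i\<in>UNIV. P i x * cnj (P i y)) + q x * cnj (q y) = g x * cnj (g y) * (of_real a - x * cnj y) powr of_real \<mu>"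
proof -
  define H where "H = (\<lambda>x y. 1 - (\<Sum>i\<in>UNIV. P i x * cnj (P i (cnj y))) + q x * cnj (q (cnj y))
     - g x * cnj (g (cnj y)) * (of_real a - x * y) powr of_real \<mu>)"
  have "joint_holo H \<rho>" unfolding H_def
    by (intro joint_holo_diff joint_holo_add joint_holo_mult joint_holo_sum joint_holo_const
        joint_holo_fst joint_holo_snd_cnj joint_holo_powr hol \<rho>)
  moreover have "H x (cnj x) = 0" if "x \<in> ball 0 \<rho>" for x
  proof -
    have "(cmod x)\<^sup>2 < \<rho>\<^sup>2" using that by (intro power_strict_mono) auto
    hence pos: "a - (cmod x)\<^sup>2 > 0" using \<rho> by simp
    have e: "of_real a - x * cnj x = complex_of_real (a - (cmod x)\<^sup>2)"
      by (simp add: complex_norm_square del: of_real_power)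
    have "H x (cnj x) = of_real (1 - (\<Sum>i\<in>UNIV. (cmod (P i x))\<^sup>2) + (cmod (q x))\<^sup>2 - (cmod (g x))\<^sup>2 * (a - (cmod x)\<^sup>2) powr \<mu>)"
    proof -
      have "(of_real a - x * cnj x) powr of_real \<mu> = complex_of_real ((a - (cmod x)\<^sup>2) powr \<mu>)"
        unfolding e using pos by (intro powr_of_real) simp
      thus ?thesis unfolding H_def complex_cnj_cnj
        by (simp add: complex_norm_square del: of_real_power)
    qed
    thus ?thesis using eq[OF that] by simp
  qed
  moreover have "cnj y \<in> ball 0 \<rho>" using y by simp
  ultimately have "H x (cnj y) = 0" using polarization_disc x by blast
  thus ?thesis unfolding H_def by simp
qed

text \<open>Put \<open>y = 0\<close> in the polarized identity: both the left side and the power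
  become 1, so \<open>g x * cnj (g 0) = 1\<close>. Hence \<open>g\<close> is constant of modulus
  1.\<close>

lemma disc_normalised:
  fixes P :: "'i::finite \<Rightarrow> complex \<Rightarrow> complex"
  assumes hol: "\<And>i. P i holomorphic_on ball 0 1" "q holomorphic_on ball 0 1" "g holomorphic_on ball 0 1"
    and eq: "\<And>x. x \<in> ball 0 1 \<Longrightarrow> 1 - (\<Sum>i\<in>UNIV. (cmod (P i x))\<^sup>2) + (cmod (q x))\<^sup>2 = (cmod (g x))\<^sup>2 * (1 - (cmod x)\<^sup>2) powr \<mu>"
    and zero: "\<And>i. P i 0 = 0" "q 0 = 0" and x: "x \<in> ball 0 1"
  shows "1 - (\<Sum>i\<in>UNIV. (cmod (P i x))\<^sup>2) + (cmod (q x))\<^sup>2 = (1 - (cmod x)\<^sup>2) powr \<mu>"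
proof -
  have "g x * cnj (g 0) = 1" if "x \<in> ball 0 1" for x
    using polarized_norm_identity[of 1 1 P q g \<mu> x 0, OF _ _ hol eq] that by (simp add: zero)
  hence *: "cmod (g x) * cmod (g 0) = 1" if "x \<in> ball 0 1" for x
    using that by (metis norm_mult norm_one complex_mod_cnj)
  hence "(cmod (g 0))\<^sup>2 = 1" by (simp add: power2_eq_square)
  hence "cmod (g 0) = 1" by (metis norm_ge_zero power2_eq_1_iff neg_0_le_iff_le not_one_le_zero)
  hence "cmod (g x) = 1" using *[OF x] by simp
  thus ?thesis using eq[OF x] by simp
qed

subsection \<open>Automorphisms of the type IV domain\<close>

definition holo_fun :: "(complex^'a \<Rightarrow> complex) \<Rightarrow> complex^'a \<Rightarrow> bool" where
  "holo_fun f z \<longleftrightarrow> (\<exists>L. (f has_derivative L) (at z) \<and> (\<forall>c v. L (c *s v) = c * L v))"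

lemma holo_fun_const: "holo_fun (\<lambda>z. c) z"
  unfolding holo_fun_def by (rule exI[of _ "\<lambda>v. 0"]) simp

lemma holo_fun_nth: "holo_fun (\<lambda>z. z $ i) z"
  unfolding holo_fun_def
  by (rule exI[of _ "\<lambda>v. v $ i"]) (auto intro: bounded_linear_imp_has_derivative bounded_linear_vec_nth)

lemma holo_fun_add: "holo_fun f z \<Longrightarrow> holo_fun g z \<Longrightarrow> holo_fun (\<lambda>z. f z + g z) z"
  unfolding holo_fun_def by (elim exE conjE, rule exI, rule conjI, erule (1) has_derivative_add) (simp add: algebra_simps)

lemma holo_fun_minus: "holo_fun f z \<Longrightarrow> holo_fun (\<lambda>z. - f z) z"
  unfolding holo_fun_def by (elim exE conjE, rule exI, rule conjI, erule has_derivative_minus) simp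

lemma holo_fun_diff: "holo_fun f z \<Longrightarrow> holo_fun g z \<Longrightarrow> holo_fun (\<lambda>z. f z - g z) z"
  using holo_fun_add[of f z "\<lambda>z. - g z"] by (simp add: holo_fun_minus)

lemma holo_fun_mult: "holo_fun f z \<Longrightarrow> holo_fun g z \<Longrightarrow> holo_fun (\<lambda>z. f z * g z) z"
  unfolding holo_fun_def by (elim exE conjE, rule exI, rule conjI, erule (1) has_derivative_mult) (simp add: algebra_simps)

lemma holo_fun_divide: "holo_fun f z \<Longrightarrow> holo_fun g z \<Longrightarrow> g z \<noteq> 0 \<Longrightarrow> holo_fun (\<lambda>z. f z / g z) z"
  unfolding holo_fun_def by (elim exE conjE, rule exI, rule conjI, erule (2) has_derivative_divide') (simp add: ring_distribs diff_divide_distrib mult_ac)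

lemma holo_fun_sum: "(\<And>i. i \<in> I \<Longrightarrow> holo_fun (f i) z) \<Longrightarrow> holo_fun (\<lambda>z. \<Sum>i\<in>I. f i z) z"
  by (induction I rule: infinite_finite_induct) (simp_all add: holo_fun_const holo_fun_add)

lemma holo_fun_zzt: "holo_fun zzt z"
  unfolding zzt_def[abs_def] power2_eq_square by (intro holo_fun_sum holo_fun_mult holo_fun_nth)

lemma holo_mapI_components:
  fixes F :: "complex^'a \<Rightarrow> complex^'b"
  assumes "\<And>z i. z \<in> S \<Longrightarrow> holo_fun (\<lambda>z. F z $ i) z"
  shows "holo_map F S"
  unfolding holo_map_def
proof
  fix z assume "z \<in> S"
  from assms[OF this] obtain L where L: "\<And>i. ((\<lambda>z. F z $ i) has_derivative L i) (at z)"
    "\<And>i c v. L i (c *s v) = c * L i v"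
    unfolding holo_fun_def by metis
  have bl: "bounded_linear (axis i :: complex \<Rightarrow> complex^'b)" for i
    unfolding linear_conv_bounded_linear[symmetric]
    by (rule linearI) (simp_all add: axis_def vec_eq_iff)
  have sum_axis: "(\<Sum>i\<in>UNIV. axis i (x i)) = (\<chi> i. x i)" for x :: "'b \<Rightarrow> complex"
    by (simp add: vec_eq_iff axis_def)
  have "((\<lambda>z. \<Sum>i\<in>UNIV. axis i (F z $ i)) has_derivative (\<lambda>v. \<Sum>i\<in>UNIV. axis i (L i v))) (at z)"
    by (intro has_derivative_sum bounded_linear.has_derivative[OF bl] L)
  hence "(F has_derivative (\<lambda>v. \<chi> i. L i v)) (at z)"
    unfolding sum_axis by simp
  thus "\<exists>L. (F has_derivative L) (at z) \<and> (\<forall>c v. L (c *s v) = c *s L v)"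
    using L(2) by (intro exI[of _ "\<lambda>v. \<chi> i. L i v"]) (simp add: vec_eq_iff)
qed

lemma holo_map_component: "holo_map F S \<Longrightarrow> z \<in> S \<Longrightarrow> holo_fun (\<lambda>z. F z $ i) z"
  unfolding holo_map_def holo_fun_def
  by (drule (1) bspec, elim exE conjE, rule exI, rule conjI,
      erule bounded_linear.has_derivative[OF bounded_linear_vec_nth]) simp

lemma holo_fun_compose:
  assumes "holo_map F S" "z \<in> S" "holo_fun g (F z)"
  shows "holo_fun (\<lambda>z. g (F z)) z"
proof -
  obtain L where L: "(F has_derivative L) (at z)" "\<And>c v. L (c *s v) = c *s L v"
    using assms(1,2) unfolding holo_map_def by blast
  obtain M where M: "(g has_derivative M) (at (F z))" "\<And>c v. M (c *s v) = c * M v"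
    using assms(3) unfolding holo_fun_def by blast
  show ?thesis unfolding holo_fun_def
    using has_derivative_compose[OF L(1) M(1)] L(2) M(2) by (intro exI[of _ "\<lambda>v. M (L v)"]) simp
qed

lemma holo_map_compose:
  assumes "holo_map f S" "holo_map g T" "f ` S \<subseteq> T"
  shows "holo_map (\<lambda>z. g (f z)) S"
  using assms by (intro holo_mapI_components holo_fun_compose[OF assms(1)] holo_map_component[OF assms(2)]) auto

lemma holo_map_cong:
  assumes "holo_map f S" "open S" "\<And>z. z \<in> S \<Longrightarrow> f z = g z"
  shows "holo_map g S"
  unfolding holo_map_def
proof
  fix z assume z: "z \<in> S"
  then obtain L where L: "(f has_derivative L) (at z)" "\<And>c v. L (c *s v) = c *s L v"
    using assms(1) unfolding holo_map_def by blast
  have "(g has_derivative L) (at z)"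
    by (rule has_derivative_transform_within_open[OF L(1) assms(2) z]) (use assms(3) in auto)
  thus "\<exists>L. (g has_derivative L) (at z) \<and> (\<forall>c v. L (c *s v) = c *s L v)" using L(2) by blast
qed

section \<open>Group properties of biholomorphic automorphisms\<close>

lemma biholo_autI:
  assumes S: "open S" and f: "f ` S \<subseteq> S" and g: "g ` S \<subseteq> S" and gf: "\<And>z. z \<in> S \<Longrightarrow> g (f z) = z"
    and fg: "\<And>z. z \<in> S \<Longrightarrow> f (g z) = z" and "holo_map f S" "holo_map g S"
  shows "biholo_aut f S"
proof -
  have bij: "bij_betw f S S"
    by (rule bij_betw_byWitness[of _ g]) (use assms in auto)
  have "g z = inv_into S f z" if "z \<in> S" for z
    using that bij fg g by (metis bij_betw_def image_subset_iff inv_into_f_f)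
  from holo_map_cong[OF assms(7) S this] show ?thesis
    using bij assms(6) unfolding biholo_aut_def by blast
qed

lemma biholo_autE:
  assumes "biholo_aut f S"
  obtains "f ` S \<subseteq> S" "inv_into S f ` S \<subseteq> S" "\<And>z. z \<in> S \<Longrightarrow> inv_into S f (f z) = z"
    "\<And>z. z \<in> S \<Longrightarrow> f (inv_into S f z) = z" "holo_map f S" "holo_map (inv_into S f) S"
proof -
  have b: "bij_betw f S S" "holo_map f S" "holo_map (inv_into S f) S"
    using assms unfolding biholo_aut_def by auto
  show ?thesis
    by (rule that[OF _ _ bij_betw_inv_into_left[OF b(1)] bij_betw_inv_into_right[OF b(1)] b(2,3)])
      (use bij_betw_imp_surj_on[OF b(1)] bij_betw_imp_surj_on[OF bij_betw_inv_into[OF b(1)]] in auto)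
qed

lemma biholo_aut_inv_into:
  assumes "open S" "biholo_aut f S"
  shows "biholo_aut (inv_into S f) S"
  using assms(2) by (rule biholo_autE) (rule biholo_autI[OF assms(1), where g=f])

lemma biholo_aut_comp:
  assumes S: "open S" and f: "biholo_aut f S" and g: "biholo_aut g S"
  shows "biholo_aut (\<lambda>z. f (g z)) S"
proof (rule biholo_autE[OF f], rule biholo_autE[OF g])
  assume *: "f ` S \<subseteq> S" "inv_into S f ` S \<subseteq> S" "\<And>z. z \<in> S \<Longrightarrow> inv_into S f (f z) = z"
    "\<And>z. z \<in> S \<Longrightarrow> f (inv_into S f z) = z" "holo_map f S" "holo_map (inv_into S f) S"
    "g ` S \<subseteq> S" "inv_into S g ` S \<subseteq> S" "\<And>z. z \<in> S \<Longrightarrow> inv_into S g (g z) = z"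
    "\<And>z. z \<in> S \<Longrightarrow> g (inv_into S g z) = z" "holo_map g S" "holo_map (inv_into S g) S"
  show ?thesis
  proof (rule biholo_autI[OF S, where g="\<lambda>z. inv_into S g (inv_into S f z)"])
    show "holo_map (\<lambda>z. f (g z)) S" "holo_map (\<lambda>z. inv_into S g (inv_into S f z)) S"
      by (rule holo_map_compose[OF *(11,5,7)], rule holo_map_compose[OF *(6,12,2)])
    have m: "f z \<in> S" "g z \<in> S" "inv_into S f z \<in> S" "inv_into S g z \<in> S" if "z \<in> S" for z
      using that *(1,2,7,8) by blast+
    thus "(\<lambda>z. f (g z)) ` S \<subseteq> S" "(\<lambda>z. inv_into S g (inv_into S f z)) ` S \<subseteq> S" by blast+
    fix z assume z: "z \<in> S"
    show "inv_into S g (inv_into S f (f (g z))) = z"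
      unfolding *(3)[OF m(2)[OF z]] by (rule *(9)[OF z])
    show "f (g (inv_into S g (inv_into S f z))) = z"
      unfolding *(10)[OF m(3)[OF z]] by (rule *(4)[OF z])
  qed
qed

text \<open>\<open>d\<close> is the automorphy factor of the generic norm.\<close>
definition gen_aut :: "(complex^'m \<Rightarrow> complex^'m) \<Rightarrow> (complex^'m \<Rightarrow> complex) \<Rightarrow> bool" where
  "gen_aut f d \<longleftrightarrow> biholo_aut f typeIV \<and>
     (\<forall>Z\<in>typeIV. holo_fun d Z \<and> d Z \<noteq> 0 \<and> gen_norm (f Z) * (cmod (d Z))\<^sup>2 = gen_norm Z)"

lemma gen_aut_mem: "gen_aut f d \<Longrightarrow> Z \<in> typeIV \<Longrightarrow> f Z \<in> typeIV"
  unfolding gen_aut_def biholo_aut_def by (meson bij_betwE)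

lemma gen_aut_comp:
  assumes f: "gen_aut f d" and g: "gen_aut g e"
  shows "gen_aut (\<lambda>Z. f (g Z)) (\<lambda>Z. d (g Z) * e Z)"
proof -
  have hg: "holo_map g typeIV" using g unfolding gen_aut_def biholo_aut_def by blast
  have "biholo_aut (\<lambda>Z. f (g Z)) typeIV"
    using f g unfolding gen_aut_def by (blast intro: biholo_aut_comp[OF open_typeIV])
  moreover have "holo_fun (\<lambda>Z. d (g Z) * e Z) Z \<and> d (g Z) * e Z \<noteq> 0 \<and>
      gen_norm (f (g Z)) * (cmod (d (g Z) * e Z))\<^sup>2 = gen_norm Z" if Z: "Z \<in> typeIV" for Z
  proof -
    have 1: "holo_fun d (g Z)" "d (g Z) \<noteq> 0" "gen_norm (f (g Z)) * (cmod (d (g Z)))\<^sup>2 = gen_norm (g Z)"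
      using f gen_aut_mem[OF g Z] unfolding gen_aut_def by auto
    have 2: "holo_fun e Z" "e Z \<noteq> 0" "gen_norm (g Z) * (cmod (e Z))\<^sup>2 = gen_norm Z"
      using g Z unfolding gen_aut_def by auto
    have "gen_norm (f (g Z)) * (cmod (d (g Z) * e Z))\<^sup>2 = gen_norm Z"
      unfolding norm_mult power_mult_distrib mult.assoc[symmetric] 1(3) 2(3) ..
    thus ?thesis using 1 2 by (auto intro!: holo_fun_mult holo_fun_compose[OF hg Z])
  qed
  ultimately show ?thesis unfolding gen_aut_def by blast
qed

lemma gen_aut_linear:
  assumes "\<And>Z. zzbar (f Z) = zzbar Z" "\<And>Z. cmod (zzt (f Z)) = cmod (zzt Z)"
    "\<And>Z. zzbar (g Z) = zzbar Z" "\<And>Z. cmod (zzt (g Z)) = cmod (zzt Z)"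
    "\<And>Z. g (f Z) = Z" "\<And>Z. f (g Z) = Z" "holo_map f typeIV" "holo_map g typeIV"
  shows "gen_aut f (\<lambda>_. 1)"
proof -
  have "biholo_aut f typeIV"
    by (rule biholo_autI[OF open_typeIV, of f g]) (use assms in \<open>auto simp: typeIV_iff gen_norm_def\<close>)
  thus ?thesis unfolding gen_aut_def by (simp add: gen_norm_def assms holo_fun_const)
qed

lemma gen_aut_id: "gen_aut (\<lambda>Z. Z) (\<lambda>_. 1)"
  by (rule gen_aut_linear[where g="\<lambda>Z. Z"]) (auto intro: holo_mapI_components holo_fun_nth)

lemma gen_aut_phase:
  assumes u: "cmod u = 1"
  shows "gen_aut (\<lambda>Z. u *s Z) (\<lambda>_. 1)"
proof (rule gen_aut_linear[where g="\<lambda>Z. cnj u *s Z"])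
  have uu: "cnj u * u = 1" "u * cnj u = 1"
    using u by (simp_all add: complex_norm_square[symmetric] mult.commute[of "cnj u"])
  show "cnj u *s (u *s Z) = Z" "u *s (cnj u *s Z) = Z" for Z :: "complex^'a"
    by (simp_all add: vector_smult_assoc uu)
  show "cmod (zzt (u *s Z)) = cmod (zzt Z)" "cmod (zzt (cnj u *s Z)) = cmod (zzt Z)" for Z :: "complex^'a"
    by (simp_all add: zzt_smult norm_mult norm_power u)
  show "holo_map ((*s) c) (typeIV :: (complex^'a) set)" for c
    by (rule holo_mapI_components, unfold vector_smult_component, intro holo_fun_mult holo_fun_const holo_fun_nth)
  thus "holo_map ((*s) (cnj u)) (typeIV :: (complex^'a) set)" .
qed (simp_all add: zzbar_def norm_mult u)

section \<open>Boosts\<close>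

definition rprod :: "real^'m \<Rightarrow> complex^'m \<Rightarrow> complex" where
  "rprod r Z = (\<Sum>i\<in>UNIV. of_real (r $ i) * Z $ i)"

text \<open>Under \<open>Z \<mapsto> (1, Z, zzt Z / 2)\<close> the domain becomes an open part of the quadric of a real form of
  signature \<open>(m, 2)\<close>. A boost is the Lorentz transformation of that form in the plane spanned by the
  real direction \<open>r\<close> and the coordinate \<open>1 + zzt Z / 2\<close>; the condition \<open>c\<^sup>2 - 2 s\<^sup>2 = 1\<close> below is
  \<open>cosh\<^sup>2 - sinh\<^sup>2 = 1\<close>, and \<open>boost_den\<close>, \<open>boost_num\<close> are the transformed outer coordinates.\<close>
definition boost_den :: "real \<Rightarrow> real \<Rightarrow> real^'m \<Rightarrow> complex^'m \<Rightarrow> complex" where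
  "boost_den c s r Z = (of_real c * (1 + zzt Z / 2) + (1 - zzt Z / 2)) / 2 + of_real s * rprod r Z"

definition boost_num :: "real \<Rightarrow> real \<Rightarrow> real^'m \<Rightarrow> complex^'m \<Rightarrow> complex" where
  "boost_num c s r Z = (of_real c * (1 + zzt Z / 2) - (1 - zzt Z / 2)) / 2 + of_real s * rprod r Z"

definition boost :: "real \<Rightarrow> real \<Rightarrow> real^'m \<Rightarrow> complex^'m \<Rightarrow> complex^'m" where
  "boost c s r Z = (\<chi> i. (Z $ i + (of_real (c - 1) * rprod r Z + of_real s * (1 + zzt Z / 2)) * of_real (r $ i))
      / boost_den c s r Z)"

lemma cmod_zzt_le: "cmod (zzt Z) \<le> zzbar Z"
  unfolding zzt_def zzbar_def norm_power[symmetric] by (rule norm_sum)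

text \<open>A positive \<open>gen_norm\<close> gives \<open>zzbar Z < 1 + |zzt Z|^2 / 4\<close>, so
  a bound on \<open>zzt\<close> is enough. In this form membership is easy to follow under a boost,
  where \<open>zzt / 2\<close> becomes \<open>boost_num / boost_den\<close>.\<close>

lemma typeIV_iff': "Z \<in> typeIV \<longleftrightarrow> cmod (zzt Z) < 2 \<and> gen_norm Z > 0"
proof -
  have "zzbar Z < 2" if "cmod (zzt Z) < 2" "gen_norm Z > 0"
  proof -
    have "(cmod (zzt Z))\<^sup>2 < 2\<^sup>2" using that(1) by (intro power_strict_mono) auto
    thus ?thesis using that(2) unfolding gen_norm_def by simp
  qed
  thus ?thesis using cmod_zzt_le[of Z] unfolding typeIV_iff by force
qed

lemma hprod_translate:
  assumes r: "(\<Sum>i\<in>UNIV. (r $ i)\<^sup>2) = (1::real)"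
  shows "rprod r (\<chi> i. Z $ i + k * of_real (r $ i)) = rprod r Z + k"
    and "zzt (\<chi> i. Z $ i + k * of_real (r $ i)) = zzt Z + 2 * k * rprod r Z + k\<^sup>2"
    and "complex_of_real (zzbar (\<chi> i. Z $ i + k * of_real (r $ i)))
      = of_real (zzbar Z) + k * cnj (rprod r Z) + cnj k * rprod r Z + k * cnj k"
proof -
  have r': "(\<Sum>i\<in>UNIV. (complex_of_real (r $ i))\<^sup>2) = 1"
    using arg_cong[OF r, of complex_of_real] by simp
  show "rprod r (\<chi> i. Z $ i + k * of_real (r $ i)) = rprod r Z + k"
    using r' by (simp add: rprod_def algebra_simps sum.distrib power2_eq_square flip: sum_distrib_left)
  have "zzt (\<chi> i. Z $ i + k * of_real (r $ i)) =
      (\<Sum>i\<in>UNIV. (Z $ i)\<^sup>2 + 2 * k * (of_real (r $ i) * Z $ i) + k\<^sup>2 * (of_real (r $ i))\<^sup>2)"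
    unfolding zzt_def by (intro sum.cong) (auto simp: power2_eq_square algebra_simps)
  also have "\<dots> = zzt Z + 2 * k * rprod r Z + k\<^sup>2"
    by (simp add: sum.distrib zzt_def rprod_def r' flip: sum_distrib_left)
  finally show "zzt (\<chi> i. Z $ i + k * of_real (r $ i)) = zzt Z + 2 * k * rprod r Z + k\<^sup>2" .
  have "hprod (\<chi> i. Z $ i + k * of_real (r $ i)) (\<chi> i. Z $ i + k * of_real (r $ i)) =
      (\<Sum>i\<in>UNIV. Z $ i * cnj (Z $ i) + k * cnj (of_real (r $ i) * Z $ i)
        + cnj k * (of_real (r $ i) * Z $ i) + k * cnj k * (of_real (r $ i))\<^sup>2)"
    unfolding hprod_def by (simp add: algebra_simps power2_eq_square)
  also have "\<dots> = hprod Z Z + k * cnj (rprod r Z) + cnj k * rprod r Z + k * cnj k"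
    by (simp add: sum.distrib hprod_def rprod_def r' cnj_sum flip: sum_distrib_left)
  finally show "complex_of_real (zzbar (\<chi> i. Z $ i + k * of_real (r $ i)))
      = of_real (zzbar Z) + k * cnj (rprod r Z) + cnj k * rprod r Z + k * cnj k"
    unfolding hprod_self .
qed

lemma vec_divide:
  "rprod r (\<chi> i. Z $ i / d) = rprod r Z / d" "zzt (\<chi> i. Z $ i / d) = zzt Z / d\<^sup>2"
  "zzbar (\<chi> i. Z $ i / d) = zzbar Z / (cmod d)\<^sup>2"
  by (simp_all add: rprod_def zzt_def zzbar_def power_divide norm_divide flip: sum_divide_distrib)

text \<open>Put \<open>u = c a + 2 s l\<close>. The first two products are those of
  \<open>(u + b) / 2\<close> and \<open>(u - b) / 2\<close>, with sum
  \<open>(u u' + b b') / 2\<close>. What remains is the invariance of \<open>a a' / 2 - l l'\<close>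
  under the Lorentz map sending \<open>a\<close> to \<open>c a + 2 s l\<close> and \<open>l\<close>
  to \<open>c l + s a\<close>.\<close>

lemma boost_norm_identity:
  fixes c s a b l a' b' l' :: complex
  assumes "c\<^sup>2 = 1 + 2 * s\<^sup>2"
  shows "((c * a + b) / 2 + s * l) * ((c * a' + b') / 2 + s * l') + ((c * a - b) / 2 + s * l) * ((c * a' - b') / 2 + s * l')
     + l * l' - (c * l + s * a) * (c * l' + s * a') = (a * a' + b * b') / 2"
proof -
  have "((c * a + b) / 2 + s * l) * ((c * a' + b') / 2 + s * l') + ((c * a - b) / 2 + s * l) * ((c * a' - b') / 2 + s * l')
     + l * l' - (c * l + s * a) * (c * l' + s * a')
     = (a * a' + b * b') / 2 + (c\<^sup>2 - (1 + 2 * s\<^sup>2)) * (a * a' / 2 - l * l')"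
    by (simp add: field_simps power2_eq_square)
  thus ?thesis unfolding assms by simp
qed

locale boost_params =
  fixes c s :: real and r :: "real^'m"
  assumes cs: "c\<^sup>2 - 2 * s\<^sup>2 = 1" and c: "c > 0" and r: "(\<Sum>i\<in>UNIV. (r $ i)\<^sup>2) = 1"
begin

lemma cs': "(of_real c)\<^sup>2 = (1 + 2 * (of_real s)\<^sup>2 :: complex)"
  using arg_cong[OF cs, of complex_of_real] by (simp add: algebra_simps)

lemma boost_eq: "boost c s r Z = (\<chi> i. (\<chi> i. Z $ i + (of_real (c - 1) * rprod r Z + of_real s * (1 + zzt Z / 2)) * of_real (r $ i)) $ i
      / boost_den c s r Z)"
  unfolding boost_def by simp

lemma rprod_boost:
  "rprod r (boost c s r Z) = (of_real c * rprod r Z + of_real s * (1 + zzt Z / 2)) / boost_den c s r Z"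
  unfolding boost_eq vec_divide hprod_translate[OF r] by (simp add: algebra_simps)

text \<open>By \<open>c\<^sup>2 = 1 + 2 s\<^sup>2\<close> the shifted vector, before division by the
  denominator, has \<open>zzt\<close> equal to \<open>2 * boost_num * boost_den\<close>: the boost
  keeps the quadric.\<close>

lemma zzt_boost:
  assumes "boost_den c s r Z \<noteq> 0"
  shows "zzt (boost c s r Z) = 2 * boost_num c s r Z / boost_den c s r Z"
proof -
  have "zzt Z + 2 * (of_real (c - 1) * rprod r Z + of_real s * (1 + zzt Z / 2)) * rprod r Z
      + (of_real (c - 1) * rprod r Z + of_real s * (1 + zzt Z / 2))\<^sup>2 = 2 * boost_num c s r Z * boost_den c s r Z"
  proof -
    have "zzt Z + 2 * (of_real (c - 1) * rprod r Z + of_real s * (1 + zzt Z / 2)) * rprod r Z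
      + (of_real (c - 1) * rprod r Z + of_real s * (1 + zzt Z / 2))\<^sup>2 = 2 * boost_num c s r Z * boost_den c s r Z
        + ((of_real c)\<^sup>2 - (1 + 2 * (of_real s)\<^sup>2)) * ((rprod r Z)\<^sup>2 - (1 + zzt Z / 2)\<^sup>2 / 2)"
      unfolding boost_num_def boost_den_def by (simp add: field_simps power2_eq_square)
    thus ?thesis unfolding cs' by simp
  qed
  thus ?thesis unfolding boost_eq vec_divide hprod_translate[OF r]
    using assms by (simp add: power2_eq_square)
qed

lemma gen_norm_boost:
  assumes "boost_den c s r Z \<noteq> 0"
  shows "gen_norm (boost c s r Z) * (cmod (boost_den c s r Z))\<^sup>2 = gen_norm Z"
proof -
  define d where "d = boost_den c s r Z"
  define k where "k = of_real (c - 1) * rprod r Z + of_real s * (1 + zzt Z / 2)"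
  define Y where "Y = (\<chi> i. Z $ i + k * of_real (r $ i))"
  have d: "d \<noteq> 0" using assms d_def by simp
  have "zzbar (boost c s r Z) = zzbar Y / (cmod d)\<^sup>2"
    unfolding boost_eq vec_divide(3) d_def Y_def k_def by simp
  hence 1: "zzbar (boost c s r Z) * (cmod d)\<^sup>2 = zzbar Y" using d by simp
  have 2: "(cmod (zzt (boost c s r Z)))\<^sup>2 * (cmod d)\<^sup>2 = 4 * (cmod (boost_num c s r Z))\<^sup>2"
    unfolding zzt_boost[OF assms] d_def[symmetric] using d
    by (simp add: norm_mult norm_divide power_mult_distrib power_divide)
  have "gen_norm (boost c s r Z) * (cmod d)\<^sup>2 = (cmod d)\<^sup>2 - zzbar Y + (cmod (boost_num c s r Z))\<^sup>2"
    unfolding gen_norm_def using 1 2 by (simp add: ring_distribs)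
  also have "\<dots> = gen_norm Z"
  proof -
    define l where "l = rprod r Z"
    define q where "q = zzt Z"
    have "complex_of_real ((cmod d)\<^sup>2 - zzbar Y + (cmod (boost_num c s r Z))\<^sup>2) =
       d * cnj d + boost_num c s r Z * cnj (boost_num c s r Z) + l * cnj l - (k + l) * cnj (k + l) - of_real (zzbar Z)"
      unfolding Y_def of_real_diff of_real_add hprod_translate[OF r] complex_norm_square l_def[symmetric]
      by (simp add: algebra_simps)
    \<comment> \<open>The primed variables of \<open>boost_norm_identity\<close> become the
      conjugates of \<open>1 + q / 2\<close>, \<open>1 - q / 2\<close> and \<open>l\<close>.\<close>
    also have "d * cnj d + boost_num c s r Z * cnj (boost_num c s r Z) + l * cnj l - (k + l) * cnj (k + l)
       = ((1 + q / 2) * (1 + cnj q / 2) + (1 - q / 2) * (1 - cnj q / 2)) / 2"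
    proof -
      have 1: "k + l = of_real c * l + of_real s * (1 + q / 2)"
        unfolding k_def l_def q_def by (simp add: algebra_simps)
      hence 2: "cnj (k + l) = of_real c * cnj l + of_real s * (1 + cnj q / 2)"
        by simp
      have 3: "cnj d = (of_real c * (1 + cnj q / 2) + (1 - cnj q / 2)) / 2 + of_real s * cnj l"
        "cnj (boost_num c s r Z) = (of_real c * (1 + cnj q / 2) - (1 - cnj q / 2)) / 2 + of_real s * cnj l"
        unfolding d_def boost_den_def boost_num_def q_def l_def by simp_all
      have 4: "d = (of_real c * (1 + q / 2) + (1 - q / 2)) / 2 + of_real s * l"
        "boost_num c s r Z = (of_real c * (1 + q / 2) - (1 - q / 2)) / 2 + of_real s * l"
        unfolding d_def boost_den_def boost_num_def q_def l_def by simp_all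
      show ?thesis unfolding 2 3 unfolding 1 4 by (rule boost_norm_identity[OF cs'])
    qed
    also have "((1 + q / 2) * (1 + cnj q / 2) + (1 - q / 2) * (1 - cnj q / 2)) / 2 - of_real (zzbar Z) = of_real (gen_norm Z)"
      unfolding gen_norm_def of_real_diff of_real_add of_real_mult complex_norm_square q_def[symmetric] by (simp add: field_simps)
    finally have "complex_of_real ((cmod d)\<^sup>2 - zzbar Y + (cmod (boost_num c s r Z))\<^sup>2) = of_real (gen_norm Z)" .
    thus ?thesis by (simp only: of_real_eq_iff)
  qed
  finally show ?thesis unfolding d_def .
qed

text \<open>Dividing by \<open>1 - zzt Z / 2\<close>, the real parts of the remaining coordinates form a vector in the
  forward light cone, which boosts preserve.\<close>
lemma cmod_boost_num_less:
  assumes Z: "Z \<in> typeIV"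
  shows "cmod (boost_num c s r Z) < cmod (boost_den c s r Z)"
proof -
  define q where "q = zzt Z"
  define a where "a = 1 + q / 2"
  define b where "b = 1 - q / 2"
  define l where "l = rprod r Z"
  define R where "R i = Re (Z $ i * cnj b)" for i
  have q2: "cmod q < 2" and gn: "gen_norm Z > 0" using Z unfolding typeIV_iff' q_def by auto
  have ReA: "Re (a * cnj b) = 1 - (cmod q)\<^sup>2 / 4"
    unfolding a_def b_def cmod_power2 by (simp add: power2_eq_square algebra_simps)
  have "(cmod q)\<^sup>2 < 2\<^sup>2" using q2 by (intro power_strict_mono) auto
  hence Apos: "Re (a * cnj b) > 0" unfolding ReA by simp
  hence b0: "b \<noteq> 0" by auto
  have sqab: "a\<^sup>2 - b\<^sup>2 = 2 * q" unfolding a_def b_def by (simp add: power2_eq_square field_simps)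
  have H: "2 * zzbar Z < (cmod a)\<^sup>2 + (cmod b)\<^sup>2"
    using gn unfolding gen_norm_def q_def[symmetric] a_def b_def cmod_power2
    by (simp add: power2_eq_square algebra_simps)
  \<comment> \<open>The light cone condition with the denominator \<open>b\<close> cleared. Writing
    \<open>2 (Re w)^2 = |w|^2 + Re (w^2)\<close> splits the sum into a part governed by
    \<open>zzbar\<close> and a part governed by \<open>zzt\<close>, and
    \<open>2 q = a^2 - b^2\<close> reassembles the bound to the same shape for
    \<open>a * cnj b\<close>.\<close>
  have key: "2 * (\<Sum>i\<in>UNIV. (R i)\<^sup>2) < (Re (a * cnj b))\<^sup>2"
  proof -
    have re2: "2 * (Re w)\<^sup>2 = (cmod w)\<^sup>2 + Re (w\<^sup>2)" for w
      by (simp only: cmod_power2) (simp add: power2_eq_square)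
    have "2 * (2 * (\<Sum>i\<in>UNIV. (R i)\<^sup>2)) = 2 * (\<Sum>i\<in>UNIV. (cmod (Z $ i * cnj b))\<^sup>2 + Re ((Z $ i * cnj b)\<^sup>2))"
      unfolding R_def re2[symmetric] by (simp add: sum_distrib_left)
    also have "\<dots> = 2 * zzbar Z * (cmod b)\<^sup>2 + Re (2 * q * (cnj b)\<^sup>2)"
      unfolding q_def zzt_def zzbar_def
      by (simp add: sum.distrib norm_mult power_mult_distrib sum_distrib_left sum_distrib_right ring_distribs sum_subtractf mult_ac)
    also have "\<dots> < ((cmod a)\<^sup>2 + (cmod b)\<^sup>2) * (cmod b)\<^sup>2 + Re (2 * q * (cnj b)\<^sup>2)"
      using H b0 by simp
    also have "2 * q * (cnj b)\<^sup>2 = (a * cnj b)\<^sup>2 - (of_real ((cmod b)\<^sup>2))\<^sup>2"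
      unfolding sqab[symmetric] complex_norm_square by (simp add: power_mult_distrib algebra_simps)
    also have "((cmod a)\<^sup>2 + (cmod b)\<^sup>2) * (cmod b)\<^sup>2 + Re ((a * cnj b)\<^sup>2 - (of_real ((cmod b)\<^sup>2))\<^sup>2)
       = (cmod (a * cnj b))\<^sup>2 + Re ((a * cnj b)\<^sup>2)"
    proof -
      have "Re ((complex_of_real ((cmod b)\<^sup>2))\<^sup>2) = (cmod b)\<^sup>2 * (cmod b)\<^sup>2"
        unfolding of_real_power[symmetric] Re_complex_of_real by (simp add: power2_eq_square)
      thus ?thesis by (simp only: minus_complex.sel norm_mult power_mult_distrib complex_mod_cnj ring_distribs)
    qed
    also have "\<dots> = 2 * (Re (a * cnj b))\<^sup>2" unfolding re2 ..
    finally show ?thesis by simp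
  qed
  have "Re (l * cnj b) = (\<Sum>i\<in>UNIV. r $ i * R i)"
  proof -
    have "l * cnj b = (\<Sum>i\<in>UNIV. of_real (r $ i) * (Z $ i * cnj b))"
      unfolding l_def rprod_def by (simp add: sum_distrib_right sum_distrib_left mult_ac)
    thus ?thesis unfolding R_def by (simp only: Re_sum Re_complex_of_real Im_complex_of_real times_complex.sel) simp
  qed
  hence L: "(Re (l * cnj b))\<^sup>2 \<le> (\<Sum>i\<in>UNIV. (R i)\<^sup>2)"
    using Cauchy_Schwarz_ineq_sum[of "\<lambda>i. r $ i" R UNIV] r by simp
  have "(2 * s * Re (l * cnj b))\<^sup>2 < (c * Re (a * cnj b))\<^sup>2"
  proof -
    have "(2 * s * Re (l * cnj b))\<^sup>2 = 4 * s\<^sup>2 * (Re (l * cnj b))\<^sup>2" by (simp add: power_mult_distrib)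
    also have "\<dots> \<le> 4 * s\<^sup>2 * (\<Sum>i\<in>UNIV. (R i)\<^sup>2)" by (intro mult_left_mono L) simp
    also have "\<dots> = 2 * s\<^sup>2 * (2 * (\<Sum>i\<in>UNIV. (R i)\<^sup>2))" by simp
    also have "\<dots> \<le> 2 * s\<^sup>2 * (Re (a * cnj b))\<^sup>2" by (intro mult_left_mono less_imp_le[OF key]) simp
    also have "\<dots> < c\<^sup>2 * (Re (a * cnj b))\<^sup>2" using cs Apos by (intro mult_strict_right_mono) auto
    finally show ?thesis by (simp add: power_mult_distrib)
  qed
  hence "\<bar>2 * s * Re (l * cnj b)\<bar> < c * Re (a * cnj b)"
    using power2_less_imp_less[of "\<bar>2 * s * Re (l * cnj b)\<bar>" "c * Re (a * cnj b)"] c Apos by simp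
  hence pos: "Re ((of_real c * a + 2 * of_real s * l) * cnj b) > 0"
    by (simp add: ring_distribs mult.assoc)
  \<comment> \<open>Taken at the boosted coordinate \<open>u = c a + 2 s l\<close>, this makes the
    claim equivalent to the positivity of \<open>Re (u * cnj b)\<close>.\<close>
  have "(cmod ((u + b) / 2))\<^sup>2 - (cmod ((u - b) / 2))\<^sup>2 = Re (u * cnj b)" for u
    unfolding cmod_power2 by (simp add: power2_eq_square field_simps)
  from this[of "of_real c * a + 2 * of_real s * l"] pos
  have "(cmod ((of_real c * a + 2 * of_real s * l - b) / 2))\<^sup>2 < (cmod ((of_real c * a + 2 * of_real s * l + b) / 2))\<^sup>2"
    by simp
  moreover have "(of_real c * a + 2 * of_real s * l - b) / 2 = boost_num c s r Z" 
     "(of_real c * a + 2 * of_real s * l + b) / 2 = boost_den c s r Z"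
    unfolding boost_den_def boost_num_def a_def b_def l_def q_def by (simp_all add: field_simps)
  ultimately show ?thesis by (metis norm_ge_zero power2_less_imp_less)
qed

lemma boost_den_nonzero: "Z \<in> typeIV \<Longrightarrow> boost_den c s r Z \<noteq> 0"
  using cmod_boost_num_less[of Z] by (metis norm_zero norm_ge_zero not_less)

lemma boost_mem:
  assumes Z: "Z \<in> typeIV"
  shows "boost c s r Z \<in> typeIV"
proof -
  note d = boost_den_nonzero[OF Z]
  have "cmod (zzt (boost c s r Z)) < 2"
    unfolding zzt_boost[OF d] using cmod_boost_num_less[OF Z] d by (simp add: norm_divide norm_mult divide_simps)
  moreover have "gen_norm (boost c s r Z) * (cmod (boost_den c s r Z))\<^sup>2 > 0"
    unfolding gen_norm_boost[OF d] using Z typeIV_iff by blast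
  hence "gen_norm (boost c s r Z) > 0" using d by (simp add: zero_less_mult_iff)
  ultimately show ?thesis unfolding typeIV_iff' by blast
qed

text \<open>Changing the sign of \<open>s\<close> inverts the Lorentz transformation. At the image
  point the denominator is \<open>1 / d\<close> and the shift coefficient is \<open>- k / d\<close>,
  so both the division by \<open>d\<close> and the shift by \<open>k\<close> are undone.\<close>

lemma boost_boost_minus:
  assumes Z: "Z \<in> typeIV"
  shows "boost c (- s) r (boost c s r Z) = Z"
proof -
  define q where "q = zzt Z"
  define l where "l = rprod r Z"
  define d where "d = boost_den c s r Z"
  define k where "k = of_real (c - 1) * l + of_real s * (1 + q / 2)"
  have d: "d \<noteq> 0" using boost_den_nonzero[OF Z] d_def by simp
  have dd: "d = (of_real c * (1 + q / 2) + (1 - q / 2)) / 2 + of_real s * l"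
    unfolding d_def boost_den_def l_def q_def ..
  define y where "y = boost_num c s r Z"
  have yy: "y = (of_real c * (1 + q / 2) - (1 - q / 2)) / 2 + of_real s * l"
    unfolding y_def boost_num_def l_def q_def ..
  have z': "zzt (boost c s r Z) / 2 = y / d"
    unfolding zzt_boost[OF boost_den_nonzero[OF Z]] d_def y_def l_def q_def by simp
  have l': "rprod r (boost c s r Z) = (of_real c * l + of_real s * (1 + q / 2)) / d"
    unfolding rprod_boost d_def l_def q_def ..
  have "boost_den c (- s) r (boost c s r Z) = ((of_real c * (d + y) + (d - y)) / 2 - of_real s * (of_real c * l + of_real s * (1 + q / 2))) / d"
    unfolding boost_den_def z' l' using d by (simp add: field_simps)
  also have "(of_real c * (d + y) + (d - y)) / 2 - of_real s * (of_real c * l + of_real s * (1 + q / 2)) = 1"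
  proof -
    have "(of_real c * (d + y) + (d - y)) / 2 - of_real s * (of_real c * l + of_real s * (1 + q / 2))
      = 1 + ((of_real c)\<^sup>2 - (1 + 2 * (of_real s)\<^sup>2)) * (1 + q / 2) / 2"
      unfolding dd yy by (simp add: field_simps power2_eq_square)
    thus ?thesis unfolding cs' by simp
  qed
  finally have den: "boost_den c (- s) r (boost c s r Z) = 1 / d" .
  have k': "of_real (c - 1) * rprod r (boost c s r Z) + of_real (- s) * (1 + zzt (boost c s r Z) / 2) = - k / d"
  proof -
    have "of_real (c - 1) * (of_real c * l + of_real s * (1 + q / 2)) - of_real s * (d + y) = - k"
    proof -
      have "of_real (c - 1) * (of_real c * l + of_real s * (1 + q / 2)) - of_real s * (d + y)
         = - k + ((of_real c)\<^sup>2 - (1 + 2 * (of_real s)\<^sup>2)) * l"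
        unfolding dd yy k_def by (simp add: field_simps power2_eq_square)
      thus ?thesis unfolding cs' by simp
    qed
    moreover have "of_real (c - 1) * (x / d) + of_real (- s) * (1 + y / d) = (of_real (c - 1) * x - of_real s * (d + y)) / d" for x
      using d by (simp add: add_divide_distrib diff_divide_distrib ring_distribs)
    ultimately show ?thesis unfolding z' l' by simp
  qed
  have Zi: "boost c s r Z $ i = (Z $ i + k * of_real (r $ i)) / d" for i
    unfolding boost_def k_def d_def l_def q_def by simp
  show ?thesis
    unfolding boost_def[of c "- s"] den k' using d by (simp add: vec_eq_iff Zi field_simps)
qed

lemma holo_map_boost: "holo_map (boost c s r) typeIV"
  by (rule holo_mapI_components)
    (simp add: boost_def boost_den_nonzero, unfold boost_den_def rprod_def,
     intro holo_fun_divide holo_fun_add holo_fun_mult holo_fun_diff holo_fun_sum holo_fun_nth holo_fun_const holo_fun_zzt,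
     fold rprod_def, fold boost_den_def, simp_all add: boost_den_nonzero)

end

lemma gen_aut_boost:
  assumes "boost_params c s r"
  shows "gen_aut (boost c s r) (boost_den c s r)"
proof -
  interpret p: boost_params c s r by fact
  interpret m: boost_params c "-s" r
    using assms by unfold_locales (auto simp: boost_params_def)
  have "biholo_aut (boost c s r) typeIV"
    using p.boost_boost_minus m.boost_boost_minus p.boost_mem m.boost_mem
    by (intro biholo_autI[where g="boost c (- s) r"] p.holo_map_boost m.holo_map_boost) auto
  moreover have "holo_fun (boost_den c s r) Z" for Z
    unfolding boost_den_def[abs_def] rprod_def
    by (intro holo_fun_divide holo_fun_add holo_fun_mult holo_fun_diff holo_fun_sum holo_fun_nth holo_fun_const holo_fun_zzt) auto
  ultimately show ?thesis
    unfolding gen_aut_def using p.boost_den_nonzero p.gen_norm_boost by blast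
qed

text \<open>A real \<open>zzt p\<close> means that the real and imaginary parts of \<open>p\<close>
  are orthogonal. A boost along the real part can therefore cancel it, while the imaginary part is
  only rescaled by the real denominator.\<close>

lemma kill_real_part:
  fixes p :: "complex^'m"
  assumes p: "p \<in> typeIV" and t: "zzt p = of_real t"
  shows "\<exists>f d k. gen_aut f d \<and> (\<forall>i. f p $ i = of_real k * (\<i> * of_real (Im (p $ i))))"
proof (cases "\<forall>i. Re (p $ i) = 0")
  case True
  have "\<forall>i. p $ i = of_real 1 * (\<i> * of_real (Im (p $ i)))"
    using True by (simp add: complex_eq_iff)
  thus ?thesis using gen_aut_id by blast
next
  case False
  define X where "X = (\<Sum>i\<in>UNIV. (Re (p $ i))\<^sup>2)"
  define n where "n = sqrt X"
  define r where "r = (\<chi> i. Re (p $ i) / n)"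
  \<comment> \<open>By \<open>rprod_boost\<close> the component along \<open>r\<close> disappears
    when \<open>c n + s a = 0\<close>. With \<open>c\<^sup>2 - 2 s\<^sup>2 = 1\<close> and
    \<open>c > 0\<close> this forces \<open>c = a / D\<close> and \<open>s = - n / D\<close> for
    \<open>D\<^sup>2 = a\<^sup>2 - 2 n\<^sup>2\<close>, and that number is
    \<open>gen_norm p\<close>.\<close>
  define a where "a = 1 + t / 2"
  define D where "D = sqrt (gen_norm p)"
  define c where "c = a / D"
  define s where "s = - n / D"
  from False obtain i0 where "Re (p $ i0) \<noteq> 0" by blast
  hence X: "X > 0" unfolding X_def by (intro sum_pos2[of _ i0]) auto
  hence n: "n > 0" "n\<^sup>2 = X" unfolding n_def by auto
  have gn: "gen_norm p > 0" and t2: "\<bar>t\<bar> < 2" using p unfolding typeIV_iff' t by auto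
  have D: "D > 0" "D\<^sup>2 = gen_norm p" unfolding D_def using gn by auto
  have Ret: "X - (\<Sum>i\<in>UNIV. (Im (p $ i))\<^sup>2) = t"
    using arg_cong[OF t, of Re] unfolding zzt_def X_def
    by (simp only: Re_sum Re_power2 sum_subtractf Re_complex_of_real)
  have "(\<Sum>i\<in>UNIV. 2 * (Re (p $ i) * Im (p $ i))) = 0"
    using arg_cong[OF t, of Im] unfolding zzt_def by (simp only: Im_sum Im_power2 Im_complex_of_real mult.assoc)
  hence ReIm: "(\<Sum>i\<in>UNIV. Re (p $ i) * Im (p $ i)) = 0" by (simp flip: sum_distrib_left)
  have zb: "zzbar p = X + (\<Sum>i\<in>UNIV. (Im (p $ i))\<^sup>2)"
    unfolding zzbar_def cmod_power2 X_def by (simp add: sum.distrib)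
  have gn_eq: "gen_norm p = a\<^sup>2 - 2 * n\<^sup>2"
  proof -
    have "1 - (X + Y) + 1/4 * (cmod (of_real (X - Y)))\<^sup>2 = (1 + (X - Y) / 2)\<^sup>2 - 2 * X" for Y :: real
      unfolding norm_of_real power2_abs by (simp add: power2_eq_square field_simps)
    thus ?thesis unfolding gen_norm_def zb t a_def n Ret[symmetric] .
  qed
  interpret boost_params c s r
  proof
    show "c\<^sup>2 - 2 * s\<^sup>2 = 1" unfolding c_def s_def power_divide D using gn gn_eq
      by (simp add: divide_simps)
    show "c > 0" unfolding c_def a_def using t2 D by simp
    show "(\<Sum>i\<in>UNIV. (r $ i)\<^sup>2) = 1"
      unfolding r_def using n X by (simp add: power_divide X_def flip: sum_divide_distrib)
  qed
  have l: "rprod r p = of_real n"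
  proof (rule complex_eqI)
    show "Re (rprod r p) = Re (of_real n)"
      using n X unfolding rprod_def r_def 
      by (simp add: X_def power2_eq_square flip: sum_divide_distrib) (simp add: field_simps)
    show "Im (rprod r p) = Im (of_real n)"
      unfolding rprod_def r_def by (simp add: ReIm flip: sum_divide_distrib)
  qed
  define dd where "dd = (c * a + (1 - t / 2)) / 2 + s * n"
  have den: "boost_den c s r p = of_real dd"
    unfolding boost_den_def l t dd_def a_def by simp
  have "(c - 1) * n + s * a = - n"
    unfolding c_def s_def by (simp add: algebra_simps)
  hence "complex_of_real ((c - 1) * n + s * a) = of_real (- n)" by (simp only:)
  hence num: "of_real (c - 1) * rprod r p + of_real s * (1 + zzt p / 2) = - of_real n"
    unfolding l t a_def by simp
  have "boost c s r p $ i = of_real (1 / dd) * (\<i> * of_real (Im (p $ i)))" for i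
    unfolding boost_def num den using n by (simp add: r_def complex_eq_iff)
  thus ?thesis using gen_aut_boost[OF boost_params_axioms] by blast
qed

text \<open>A phase makes \<open>zzt p\<close> real and a boost removes the real part.
  Multiplication by \<open>- \<i>\<close> then turns the purely imaginary remainder into a real
  vector, whose \<open>zzt\<close> is real again, so a second boost carries it to 0.\<close>

lemma gen_aut_transitive:
  fixes p :: "complex^'m"
  assumes p: "p \<in> typeIV"
  shows "\<exists>f d. gen_aut f d \<and> f p = 0"
proof -
  obtain u t where u: "cmod u = 1" "u\<^sup>2 * zzt p = of_real t"
  proof (cases "zzt p = 0")
    case True thus ?thesis using that[of 1 0] by simp
  next
    case False
    \<comment> \<open>The phase opposite to that of a square root of \<open>zzt p\<close>, so that
      \<open>w\<^sup>2\<close> cancels the phase of \<open>zzt p\<close>.\<close>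
    define w where "w = cnj (csqrt (zzt p)) / of_real (cmod (csqrt (zzt p)))"
    have "w\<^sup>2 * zzt p = w\<^sup>2 * (csqrt (zzt p))\<^sup>2" by simp
    also have "\<dots> = (w * csqrt (zzt p))\<^sup>2" by (simp add: power_mult_distrib)
    also have "w * csqrt (zzt p) = of_real (cmod (csqrt (zzt p)))"
      unfolding w_def using False 
      by (simp add: field_simps complex_norm_square[symmetric] power2_eq_square del: of_real_mult flip: of_real_mult)
    also have "(complex_of_real (cmod (csqrt (zzt p))))\<^sup>2 = of_real ((cmod (csqrt (zzt p)))\<^sup>2)" by (rule of_real_power[symmetric])
    finally have "w\<^sup>2 * zzt p = of_real ((cmod (csqrt (zzt p)))\<^sup>2)" .
    moreover have "cmod w = 1" unfolding w_def using False by (simp add: norm_divide)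
    ultimately show ?thesis using that by blast
  qed
  note ph = gen_aut_phase[OF u(1), where ?'a='m]
  have "zzt (u *s p) = of_real t" unfolding zzt_smult u ..
  from kill_real_part[OF gen_aut_mem[OF ph p] this] obtain f d k
    where f: "gen_aut f d" "\<And>i. f (u *s p) $ i = of_real k * (\<i> * of_real (Im ((u *s p) $ i)))" by blast
  define y where "y = (-\<i>) *s f (u *s p)"
  have ph': "gen_aut (\<lambda>Z::complex^'m. (-\<i>) *s Z) (\<lambda>_. 1)" by (rule gen_aut_phase) simp
  have y: "y $ i = of_real (k * Im ((u *s p) $ i))" for i
    unfolding y_def vector_smult_component f(2) by (simp add: algebra_simps)
  have "y \<in> typeIV" unfolding y_def by (intro gen_aut_mem[OF ph'] gen_aut_mem[OF f(1)] gen_aut_mem[OF ph] p)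
  moreover have "zzt y = of_real (\<Sum>i\<in>UNIV. (k * Im ((u *s p) $ i))\<^sup>2)" unfolding zzt_def y by simp
  ultimately obtain g e k' where g: "gen_aut g e" "\<And>i. g y $ i = of_real k' * (\<i> * of_real (Im (y $ i)))"
    using kill_real_part by blast
  have "g y = 0" by (simp add: vec_eq_iff g(2) y)
  moreover have "gen_aut (\<lambda>Z. g ((-\<i>) *s f (u *s Z))) (\<lambda>Z. (e ((-\<i>) *s f (u *s Z))) * (1 * (d (u *s Z) * 1)))"
    using gen_aut_comp[OF g(1) gen_aut_comp[OF ph' gen_aut_comp[OF f(1) ph]]] .
  ultimately show ?thesis unfolding y_def by blast
qed

text \<open>The bilinear form of the statement serves twice: \<open>y = x\<close> gives the
  invariance of \<open>zzt\<close>, and \<open>y = cnj x\<close> that of \<open>zzbar\<close>, where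
  conjugation passes the entries of \<open>A\<close> because they are real.\<close>

lemma orthogonal_sum_products:
  fixes A :: "real^'m^'m" and x y :: "'m \<Rightarrow> complex"
  assumes "transpose A ** A = mat 1"
  shows "(\<Sum>i\<in>UNIV. (\<Sum>j\<in>UNIV. of_real (A $ i $ j) * x j) * (\<Sum>k\<in>UNIV. of_real (A $ i $ k) * y k)) = (\<Sum>j\<in>UNIV. x j * y j)"
proof -
  have A: "(\<Sum>i\<in>UNIV. A $ i $ j * A $ i $ k) = (if j = k then 1 else 0)" for j k
    using arg_cong[OF assms, of "\<lambda>M. M $ j $ k"] by (simp add: matrix_matrix_mult_def transpose_def mat_def)
  have A': "(\<Sum>i\<in>UNIV. complex_of_real (A $ i $ j) * of_real (A $ i $ k)) = (if j = k then 1 else 0)" for j k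
    using arg_cong[OF A[of j k], of complex_of_real] by (cases "j = k") simp_all
  have "(\<Sum>i\<in>UNIV. (\<Sum>j\<in>UNIV. of_real (A $ i $ j) * x j) * (\<Sum>k\<in>UNIV. of_real (A $ i $ k) * y k))
     = (\<Sum>i\<in>UNIV. \<Sum>j\<in>UNIV. \<Sum>k\<in>UNIV. x j * y k * (of_real (A $ i $ j) * of_real (A $ i $ k)))"
    by (simp add: sum_product mult_ac)
  also have "\<dots> = (\<Sum>j\<in>UNIV. \<Sum>i\<in>UNIV. \<Sum>k\<in>UNIV. x j * y k * (of_real (A $ i $ j) * of_real (A $ i $ k)))"
    by (rule sum.swap)
  also have "\<dots> = (\<Sum>j\<in>UNIV. \<Sum>k\<in>UNIV. \<Sum>i\<in>UNIV. x j * y k * (of_real (A $ i $ j) * of_real (A $ i $ k)))"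
    by (intro sum.cong refl sum.swap)
  also have "\<dots> = (\<Sum>j\<in>UNIV. x j * y j)"
    by (simp add: A' flip: sum_distrib_left) (simp add: if_distrib sum.delta cong: if_cong)
  finally show ?thesis .
qed

definition real_lin :: "real^'m^'m \<Rightarrow> complex^'m \<Rightarrow> complex^'m" where
  "real_lin A Z = (\<chi> i. rprod (A $ i) Z)"

lemma
  assumes "transpose A ** A = mat 1"
  shows zzt_real_lin: "zzt (real_lin A Z) = zzt Z" and zzbar_real_lin: "zzbar (real_lin A Z) = zzbar Z"
proof -
  show "zzt (real_lin A Z) = zzt Z"
    using orthogonal_sum_products[OF assms, of "\<lambda>i. Z $ i" "\<lambda>i. Z $ i"]
    by (simp add: zzt_def real_lin_def rprod_def power2_eq_square)
  have "hprod (real_lin A Z) (real_lin A Z) = hprod Z Z"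
    using orthogonal_sum_products[OF assms, of "\<lambda>i. Z $ i" "\<lambda>i. cnj (Z $ i)"]
    by (simp add: hprod_def real_lin_def rprod_def cnj_sum)
  thus "zzbar (real_lin A Z) = zzbar Z" unfolding hprod_self by simp
qed

lemma real_lin_real_lin: "real_lin A (real_lin B Z) = real_lin (A ** B) Z"
proof -
  have "(\<Sum>i\<in>UNIV. of_real (A $ k $ i) * (\<Sum>j\<in>UNIV. of_real (B $ i $ j) * Z $ j))
     = (\<Sum>j\<in>UNIV. (\<Sum>i\<in>UNIV. of_real (A $ k $ i) * of_real (B $ i $ j)) * Z $ j)" for k
    by (simp add: sum_distrib_left sum_distrib_right mult_ac) (rule sum.swap)
  thus ?thesis unfolding real_lin_def rprod_def matrix_matrix_mult_def by (simp add: vec_eq_iff)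
qed

lemma real_lin_mat_1: "real_lin (mat 1) Z = Z"
  by (simp add: real_lin_def rprod_def mat_def vec_eq_iff if_distrib[where f=of_real] if_distrib[where f="\<lambda>x. x * _"] cong: if_cong)

lemma holo_map_real_lin: "holo_map (real_lin A) S"
  by (rule holo_mapI_components, unfold real_lin_def vec_lambda_beta rprod_def)
    (intro holo_fun_sum holo_fun_mult holo_fun_const holo_fun_nth)

lemma gen_aut_real_lin:
  assumes "orthogonal_matrix A"
  shows "gen_aut (real_lin A) (\<lambda>_. 1)"
proof -
  have A: "transpose A ** A = mat 1" "A ** transpose A = mat 1" using assms unfolding orthogonal_matrix_def by auto
  show ?thesis
    by (rule gen_aut_linear[where g="real_lin (transpose A)"])
      (use A in \<open>auto simp: zzt_real_lin zzbar_real_lin transpose_transpose real_lin_real_lin real_lin_mat_1 holo_map_real_lin\<close>)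
qed

subsection \<open>Taylor coefficients\<close>

lemma higher_deriv_powr:
  assumes "cmod c \<le> 1" "x \<in> ball 0 1"
  shows "(deriv ^^ k) (\<lambda>x. (1 - c * x) powr s) x = c ^ k * pochhammer (- s) k * (1 - c * x) powr (s - of_nat k)"
  using assms(2)
proof (induction k arbitrary: x)
  case (Suc k)
  have np: "1 - c * x \<notin> \<real>\<^sub>\<le>\<^sub>0" if "x \<in> ball 0 1" for x
  proof -
    have "cmod (c * x) < 1" using that assms(1) mult_mono[of "cmod c" 1 "cmod x" "cmod x"] by (simp add: norm_mult)
    hence "Re (c * x) < 1" using complex_Re_le_cmod[of "c * x"] by linarith
    thus ?thesis by (auto simp: complex_nonpos_Reals_iff)
  qed
  have "eventually (\<lambda>x. x \<in> ball 0 1) (nhds x)" using Suc.prems by (intro eventually_nhds_in_open) auto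
  hence "eventually (\<lambda>x. (deriv ^^ k) (\<lambda>x. (1 - c * x) powr s) x = c ^ k * pochhammer (- s) k * (1 - c * x) powr (s - of_nat k)) (nhds x)"
    by eventually_elim (rule Suc.IH)
  hence "deriv ((deriv ^^ k) (\<lambda>x. (1 - c * x) powr s)) x = deriv (\<lambda>x. c ^ k * pochhammer (- s) k * (1 - c * x) powr (s - of_nat k)) x"
    by (intro deriv_cong_ev) auto
  also have "\<dots> = c ^ Suc k * pochhammer (- s) (Suc k) * (1 - c * x) powr (s - of_nat (Suc k))"
  proof (rule DERIV_imp_deriv)
    have "((\<lambda>x. (1 - c * x) powr (s - of_nat k)) has_field_derivative (s - of_nat k) * (1 - c * x) powr (s - of_nat k - 1) * - c) (at x)"
      by (rule DERIV_chain'[of "\<lambda>x. 1 - c * x" "- c" _ _ "\<lambda>w. w powr (s - of_nat k)", THEN DERIV_cong])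
        (use np[OF Suc.prems] in \<open>auto intro!: derivative_eq_intros has_field_derivative_powr\<close>)
    from DERIV_cmult[OF this, of "c ^ k * pochhammer (- s) k"]
    show "((\<lambda>x. c ^ k * pochhammer (- s) k * (1 - c * x) powr (s - of_nat k)) has_field_derivative
        c ^ Suc k * pochhammer (- s) (Suc k) * (1 - c * x) powr (s - of_nat (Suc k))) (at x)"
      by (rule DERIV_cong) (simp add: pochhammer_Suc algebra_simps)
  qed
  finally show ?case by simp
qed simp

lemma higher_deriv_monomial: "(deriv ^^ l) (\<lambda>y::complex. C * y ^ k) 0 = (if l = k then C * fact k else 0)"
proof (induction l arbitrary: k C)
  case (Suc l)
  have "deriv (\<lambda>y. C * y ^ k) = (\<lambda>y. (C * of_nat k) * y ^ (k - 1))"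
    by (rule ext, rule DERIV_imp_deriv) (auto intro!: derivative_eq_intros)
  hence "(deriv ^^ Suc l) (\<lambda>y. C * y ^ k) 0 = (deriv ^^ l) (\<lambda>y. (C * of_nat k) * y ^ (k - 1)) 0"
    by (simp only: funpow_Suc_right o_def)
  also have "\<dots> = (if l = k - 1 then C * of_nat k * fact (k - 1) else 0)" by (rule Suc.IH)
  finally show ?case by (cases k) (auto simp: algebra_simps)
qed auto

lemma higher_deriv_affine_combination:
  fixes A :: "'i::finite \<Rightarrow> complex \<Rightarrow> complex"
  assumes "\<And>i. A i holomorphic_on ball 0 1" "a holomorphic_on ball 0 1" "k > 0"
  shows "(deriv ^^ k) (\<lambda>x. c - (\<Sum>i\<in>UNIV. A i x * B i) + a x * b) 0
    = - (\<Sum>i\<in>UNIV. (deriv ^^ k) (A i) 0 * B i) + (deriv ^^ k) a 0 * b"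
proof -
  have scale: "(deriv ^^ k) (\<lambda>x. f x * d) 0 = (deriv ^^ k) f 0 * d" if "f holomorphic_on ball 0 1" for f d
    using higher_deriv_cmult[OF that, of 0 k d] by (simp add: mult.commute)
  have sum: "(deriv ^^ k) (\<lambda>x. \<Sum>i\<in>I. A i x * B i) 0 = (\<Sum>i\<in>I. (deriv ^^ k) (A i) 0 * B i)" if "finite I" for I :: "'i set"
    using that
  proof (induction I)
    case (insert j I)
    have "(deriv ^^ k) (\<lambda>x. A j x * B j + (\<Sum>i\<in>I. A i x * B i)) 0 = (deriv ^^ k) (\<lambda>x. A j x * B j) 0 + (deriv ^^ k) (\<lambda>x. \<Sum>i\<in>I. A i x * B i) 0"
      by (rule higher_deriv_add[of _ "ball 0 1"]) (auto intro!: holomorphic_intros assms)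
    thus ?case using insert by (simp add: scale assms)
  qed (use assms(3) in simp)
  have "(deriv ^^ k) (\<lambda>x. c - (\<Sum>i\<in>UNIV. A i x * B i) + a x * b) 0
    = (deriv ^^ k) (\<lambda>x. c - (\<Sum>i\<in>UNIV. A i x * B i)) 0 + (deriv ^^ k) (\<lambda>x. a x * b) 0"
    by (rule higher_deriv_add[of _ "ball 0 1"]) (auto intro!: holomorphic_intros assms)
  also have "(deriv ^^ k) (\<lambda>x. c - (\<Sum>i\<in>UNIV. A i x * B i)) 0 = (deriv ^^ k) (\<lambda>x. c) 0 - (deriv ^^ k) (\<lambda>x. \<Sum>i\<in>UNIV. A i x * B i) 0"
    by (rule higher_deriv_diff[of _ "ball 0 1"]) (auto intro!: holomorphic_intros assms)
  finally show ?thesis using assms(3) by (simp add: scale sum assms)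
qed

text \<open>Differentiate \<open>k\<close> times in \<open>x\<close> at 0, conjugate so that the
  result is holomorphic in \<open>y\<close>, and differentiate \<open>l\<close> times there. The
  value 1 of \<kappa> belongs to two points on the same axis, the value 0 to points on orthogonal
  axes; for both, \<open>\<kappa> ^ k = \<kappa>\<close> since \<open>k > 0\<close>.\<close>

lemma taylor_gram:
  fixes A B :: "'i::finite \<Rightarrow> complex \<Rightarrow> complex"
  assumes hol: "\<And>i. A i holomorphic_on ball 0 1" "a holomorphic_on ball 0 1"
      "\<And>i. B i holomorphic_on ball 0 1" "b holomorphic_on ball 0 1"
    and \<kappa>: "\<kappa> \<in> {0, 1}"
    and eq: "\<And>x y. x \<in> ball 0 1 \<Longrightarrow> y \<in> ball 0 1 \<Longrightarrow>
       1 - (\<Sum>i\<in>UNIV. A i x * cnj (B i y)) + a x * cnj (b y) = (1 - \<kappa> * x * cnj y) powr of_real \<mu>"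
    and k: "k > 0" and l: "l > 0"
  shows "(\<Sum>i\<in>UNIV. (deriv ^^ k) (A i) 0 * cnj ((deriv ^^ l) (B i) 0))
     = (deriv ^^ k) a 0 * cnj ((deriv ^^ l) b 0) - (if k = l then \<kappa> * of_real (pochhammer (- \<mu>) k * fact k) else 0)"
proof -
  define p where "p = \<kappa> * of_real (pochhammer (- \<mu>) k)"
  have 1: "- (\<Sum>i\<in>UNIV. (deriv ^^ k) (A i) 0 * cnj (B i y)) + (deriv ^^ k) a 0 * cnj (b y) = p * cnj y ^ k"
    if y: "y \<in> ball 0 1" for y
  proof -
    have "- (\<Sum>i\<in>UNIV. (deriv ^^ k) (A i) 0 * cnj (B i y)) + (deriv ^^ k) a 0 * cnj (b y)
      = (deriv ^^ k) (\<lambda>x. 1 - (\<Sum>i\<in>UNIV. A i x * cnj (B i y)) + a x * cnj (b y)) 0"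
      by (rule higher_deriv_affine_combination[symmetric]) (use hol k in auto)
    also have "\<dots> = (deriv ^^ k) (\<lambda>x. (1 - (\<kappa> * cnj y) * x) powr of_real \<mu>) 0"
    proof (rule higher_deriv_cong_ev)
      have "eventually (\<lambda>x. x \<in> ball 0 1) (nhds (0::complex))" by (intro eventually_nhds_in_open) auto
      thus "eventually (\<lambda>x. 1 - (\<Sum>i\<in>UNIV. A i x * cnj (B i y)) + a x * cnj (b y) = (1 - (\<kappa> * cnj y) * x) powr of_real \<mu>) (nhds 0)"
        by eventually_elim (use eq y in \<open>simp add: mult_ac\<close>)
    qed simp
    also have "\<dots> = (\<kappa> * cnj y) ^ k * pochhammer (- of_real \<mu>) k"
      by (subst higher_deriv_powr) (use \<kappa> y in \<open>auto simp: norm_mult\<close>)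
    also have "\<dots> = p * cnj y ^ k"
    proof -
      have "\<kappa> ^ k = \<kappa>" using \<kappa> k by auto
      moreover have "pochhammer (- of_real \<mu>) k = complex_of_real (pochhammer (- \<mu>) k)"
        using pochhammer_of_real[of "- \<mu>" k, where ?'a=complex] by simp
      ultimately show ?thesis unfolding p_def by (simp add: power_mult_distrib)
    qed
    finally show ?thesis .
  qed
  have cp: "cnj p = p" unfolding p_def using \<kappa> by auto
  have 2: "0 - (\<Sum>i\<in>UNIV. B i y * cnj ((deriv ^^ k) (A i) 0)) + b y * cnj ((deriv ^^ k) a 0) = p * y ^ k"
    if y: "y \<in> ball 0 1" for y
    using arg_cong[OF 1[OF y], of cnj] by (simp add: cnj_sum mult.commute cp)
  have "- (\<Sum>i\<in>UNIV. (deriv ^^ l) (B i) 0 * cnj ((deriv ^^ k) (A i) 0)) + (deriv ^^ l) b 0 * cnj ((deriv ^^ k) a 0)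
     = (deriv ^^ l) (\<lambda>y. 0 - (\<Sum>i\<in>UNIV. B i y * cnj ((deriv ^^ k) (A i) 0)) + b y * cnj ((deriv ^^ k) a 0)) 0"
    by (rule higher_deriv_affine_combination[symmetric]) (use hol l in auto)
  also have "\<dots> = (deriv ^^ l) (\<lambda>y. p * y ^ k) 0"
  proof (rule higher_deriv_cong_ev)
    have "eventually (\<lambda>x. x \<in> ball 0 1) (nhds (0::complex))" by (intro eventually_nhds_in_open) auto
    thus "eventually (\<lambda>y. 0 - (\<Sum>i\<in>UNIV. B i y * cnj ((deriv ^^ k) (A i) 0)) + b y * cnj ((deriv ^^ k) a 0) = p * y ^ k) (nhds 0)"
      by eventually_elim (rule 2)
  qed simp
  also have "\<dots> = (if k = l then p * fact k else 0)" unfolding higher_deriv_monomial by auto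
  finally have "cnj (- (\<Sum>i\<in>UNIV. (deriv ^^ l) (B i) 0 * cnj ((deriv ^^ k) (A i) 0)) + (deriv ^^ l) b 0 * cnj ((deriv ^^ k) a 0))
     = cnj (if k = l then p * fact k else 0)" by (rule arg_cong)
  hence "- (\<Sum>i\<in>UNIV. (deriv ^^ k) (A i) 0 * cnj ((deriv ^^ l) (B i) 0)) + (deriv ^^ k) a 0 * cnj ((deriv ^^ l) b 0)
     = (if k = l then p * fact k else 0)"
    by (simp add: cnj_sum mult.commute cp split: if_splits)
  thus ?thesis unfolding p_def by (simp add: algebra_simps split: if_splits)
qed

lemma hprod_Cauchy_Schwarz: "(cmod (hprod Z W))\<^sup>2 \<le> zzbar Z * zzbar W"
proof -
  have "cmod (hprod Z W) \<le> (\<Sum>i\<in>UNIV. cmod (Z $ i) * cmod (W $ i))"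
    unfolding hprod_def by (rule order_trans[OF norm_sum]) (simp add: norm_mult)
  hence "(cmod (hprod Z W))\<^sup>2 \<le> (\<Sum>i\<in>UNIV. cmod (Z $ i) * cmod (W $ i))\<^sup>2" by (intro power_mono) auto
  also have "\<dots> \<le> zzbar Z * zzbar W" unfolding zzbar_def by (rule Cauchy_Schwarz_ineq_sum)
  finally show ?thesis .
qed

text \<open>Only the first factor \<open>- \<mu>\<close> is negative; the following ones
  \<open>1 - \<mu>\<close>, \<open>2 - \<mu>\<close>, ... are positive.\<close>

lemma pochhammer_minus_neg:
  assumes "0 < \<mu>" "\<mu> < 1" "k > 0"
  shows "pochhammer (- \<mu>) k < (0::real)"
proof -
  obtain j where k: "k = Suc j" using assms(3) by (cases k) auto
  have "pochhammer (- \<mu> + 1) j > 0" using assms by (intro pochhammer_pos) auto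
  thus ?thesis unfolding k pochhammer_rec using assms by (simp add: mult_neg_pos)
qed

text \<open>The infinitely many Taylor coefficients would be linearly independent.\<close>
lemma no_infinite_gram:
  fixes A :: "nat \<Rightarrow> complex^'m"
  assumes gram: "\<And>k l. k > 0 \<Longrightarrow> l > 0 \<Longrightarrow> hprod (A k) (A l) = a k * cnj (a l) + (if k = l then of_real (d k) else 0)"
    and d: "\<And>k. k > 0 \<Longrightarrow> d k > (0::real)"
  shows False
proof -
  \<comment> \<open>The squared norm of a combination is
    \<open>|\<Sum> c k * a k|^2 + \<Sum> (c k)^2 * d k\<close>, a sum of nonnegative terms. Real
    coefficients suffice because \<open>independent\<close> refers to the real structure.\<close>
  have zero: "c k = 0" if T: "finite T" "\<And>k. k \<in> T \<Longrightarrow> k > 0" and s: "(\<Sum>k\<in>T. c k *\<^sub>R A k) = 0" and k: "k \<in> T" for c T k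
  proof -
    have "0 = hprod (\<Sum>k\<in>T. c k *\<^sub>R A k) (\<Sum>k\<in>T. c k *\<^sub>R A k)" unfolding s by (simp add: hprod_def)
    also have "\<dots> = (\<Sum>i\<in>UNIV. \<Sum>k\<in>T. \<Sum>l\<in>T. of_real (c k) * of_real (c l) * (A k $ i * cnj (A l $ i)))"
      unfolding hprod_def sum_component vector_scaleR_component
      unfolding scaleR_conv_of_real by (simp add: cnj_sum sum_product mult_ac)
    also have "\<dots> = (\<Sum>k\<in>T. \<Sum>i\<in>UNIV. \<Sum>l\<in>T. of_real (c k) * of_real (c l) * (A k $ i * cnj (A l $ i)))"
      by (rule sum.swap)
    also have "\<dots> = (\<Sum>k\<in>T. \<Sum>l\<in>T. \<Sum>i\<in>UNIV. of_real (c k) * of_real (c l) * (A k $ i * cnj (A l $ i)))"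
      by (intro sum.cong refl sum.swap)
    also have "\<dots> = (\<Sum>k\<in>T. \<Sum>l\<in>T. of_real (c k) * of_real (c l) * hprod (A k) (A l))"
      unfolding hprod_def by (simp add: sum_distrib_left)
    also have "\<dots> = (\<Sum>k\<in>T. \<Sum>l\<in>T. (of_real (c k) * a k) * cnj (of_real (c l) * a l) + (if k = l then of_real (c k * c l * d k) else 0))"
      using T(2) by (intro sum.cong refl) (auto simp: gram algebra_simps)
    also have "\<dots> = (\<Sum>k\<in>T. of_real (c k) * a k) * cnj (\<Sum>k\<in>T. of_real (c k) * a k) + of_real (\<Sum>k\<in>T. (c k)\<^sup>2 * d k)"
      using T(1) by (simp add: sum.distrib sum_product cnj_sum power2_eq_square cong: if_cong)
    also have "\<dots> = of_real ((cmod (\<Sum>k\<in>T. of_real (c k) * a k))\<^sup>2 + (\<Sum>k\<in>T. (c k)\<^sup>2 * d k))"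
      unfolding of_real_add complex_norm_square ..
    finally have e: "(cmod (\<Sum>k\<in>T. of_real (c k) * a k))\<^sup>2 + (\<Sum>k\<in>T. (c k)\<^sup>2 * d k) = 0"
      by (metis of_real_eq_0_iff)
    have nn: "(c k)\<^sup>2 * d k \<ge> 0" if "k \<in> T" for k using d[of k] T(2)[OF that] by simp
    have "(\<Sum>k\<in>T. (c k)\<^sup>2 * d k) = 0"
      using e sum_nonneg[of T "\<lambda>k. (c k)\<^sup>2 * d k", OF nn] zero_le_power2[of "cmod (\<Sum>k\<in>T. of_real (c k) * a k)"] by linarith
    hence "(c k)\<^sup>2 * d k = 0" using sum_nonneg_eq_0_iff[of T "\<lambda>k. (c k)\<^sup>2 * d k"] T(1) nn k by blast
    thus ?thesis using d[of k] T(2)[OF k] by simp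
  qed
  have inj: "inj_on A {0<..}"
  proof (rule inj_onI, rule ccontr)
    fix k l :: nat assume kl: "k \<in> {0<..}" "l \<in> {0<..}" "A k = A l" "k \<noteq> l"
    have "(\<lambda>j. if j = k then 1 else - 1 :: real) k = 0"
      by (rule zero[of "{k, l}"]) (use kl in auto)
    thus False by simp
  qed
  have "independent (A ` {0<..})"
    unfolding dependent_explicit
  proof safe
    fix t u v assume t: "finite t" "t \<subseteq> A ` {0<..}" and s: "(\<Sum>v\<in>t. u v *\<^sub>R v) = 0" and v: "v \<in> t" "u v \<noteq> 0"
    obtain T where T: "T \<subseteq> {0<..}" "finite T" "t = A ` T" using finite_subset_image[OF t] by blast
    have injT: "inj_on A T" using inj_on_subset[OF inj T(1)] .
    obtain k where k: "k \<in> T" "v = A k" using v(1) T(3) by blast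
    have "(\<Sum>k\<in>T. u (A k) *\<^sub>R A k) = 0" using s unfolding T(3) by (simp add: sum.reindex[OF injT])
    hence "u (A k) = 0" using zero[of T "\<lambda>k. u (A k)" k] T k(1) by auto
    thus False using v k by simp
  qed
  hence "finite (A ` {0<..})" by (rule finiteI_independent)
  hence "finite {0::nat<..}" using finite_image_iff[OF inj] by simp
  thus False by (simp add: infinite_Ioi)
qed

subsection \<open>Linear span of the image\<close>

text \<open>Equal inner products give corresponding combinations of the \<open>u i\<close> and the
  \<open>v i\<close> the same norm, so every relation among the \<open>v i\<close> is one among the
  \<open>u i\<close>. Indices that yield a basis on the \<open>u\<close> side thus yield independent
  vectors on the \<open>v\<close> side.\<close>

lemma dim_le_of_equal_inner:
  fixes u :: "'a \<Rightarrow> 'e::euclidean_space" and v :: "'a \<Rightarrow> 'f::euclidean_space"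
  assumes gram: "\<And>i j. i \<in> I \<Longrightarrow> j \<in> I \<Longrightarrow> u i \<bullet> u j = v i \<bullet> v j"
  shows "dim (u ` I) \<le> DIM('f)"
proof -
  obtain B where B: "B \<subseteq> u ` I" "independent B" "card B = dim (u ` I)"
    using basis_exists[of "u ` I"] by metis
  have finB: "finite B" using B(2) by (rule finiteI_independent)
  define \<sigma> where "\<sigma> b = (SOME i. i \<in> I \<and> u i = b)" for b
  have "\<exists>i. i \<in> I \<and> u i = b" if "b \<in> B" for b using B(1) that by blast
  hence \<sigma>: "\<sigma> b \<in> I" "u (\<sigma> b) = b" if "b \<in> B" for b
    unfolding \<sigma>_def using someI_ex[of "\<lambda>i. i \<in> I \<and> u i = b"] that by blast+
  have zero: "c b = 0" if s: "(\<Sum>b\<in>B. c b *\<^sub>R v (\<sigma> b)) = 0" and b: "b \<in> B" for c b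
  proof -
    have "(\<Sum>b\<in>B. c b *\<^sub>R b) \<bullet> (\<Sum>b\<in>B. c b *\<^sub>R b) = (\<Sum>b\<in>B. \<Sum>b'\<in>B. c b * c b' * (u (\<sigma> b) \<bullet> u (\<sigma> b')))"
      by (simp add: inner_sum_left inner_sum_right \<sigma> sum_distrib_left mult_ac inner_commute)
    also have "\<dots> = (\<Sum>b\<in>B. \<Sum>b'\<in>B. c b * c b' * (v (\<sigma> b) \<bullet> v (\<sigma> b')))"
      by (intro sum.cong refl arg_cong2[where f="(*)"] gram \<sigma>(1))
    also have "\<dots> = (\<Sum>b\<in>B. c b *\<^sub>R v (\<sigma> b)) \<bullet> (\<Sum>b\<in>B. c b *\<^sub>R v (\<sigma> b))"
      by (simp add: inner_sum_left inner_sum_right sum_distrib_left mult_ac inner_commute)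
    finally have "(\<Sum>b\<in>B. c b *\<^sub>R b) = 0" unfolding s by simp
    thus ?thesis using independentD[OF B(2) finB order_refl _ b] by blast
  qed
  have inj: "inj_on (\<lambda>b. v (\<sigma> b)) B"
  proof (rule inj_onI, rule ccontr)
    fix x y assume xy: "x \<in> B" "y \<in> B" "v (\<sigma> x) = v (\<sigma> y)" "x \<noteq> y"
    define c where "c b = (if b = x then 1 else if b = y then -1 else 0 :: real)" for b
    have "(\<Sum>b\<in>B. c b *\<^sub>R v (\<sigma> b)) = (\<Sum>b\<in>{x, y}. c b *\<^sub>R v (\<sigma> b))"
      by (rule sum.mono_neutral_right) (use finB xy in \<open>auto simp: c_def\<close>)
    also have "\<dots> = 0" using xy by (simp add: c_def)
    finally have "c x = 0" using zero xy(1) by blast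
    thus False by (simp add: c_def)
  qed
  have "independent ((\<lambda>b. v (\<sigma> b)) ` B)"
    unfolding independent_explicit
  proof safe
    show "finite ((\<lambda>b. v (\<sigma> b)) ` B)" using finB by simp
    fix c b assume s: "(\<Sum>x\<in>(\<lambda>b. v (\<sigma> b)) ` B. c x *\<^sub>R x) = 0" and b: "b \<in> B"
    have "(\<Sum>b\<in>B. c (v (\<sigma> b)) *\<^sub>R v (\<sigma> b)) = 0" using s by (simp add: sum.reindex[OF inj])
    thus "c (v (\<sigma> b)) = 0" using zero[of "\<lambda>b. c (v (\<sigma> b))"] b by blast
  qed
  hence "card ((\<lambda>b. v (\<sigma> b)) ` B) \<le> DIM('f)" using independent_bound by blast
  thus ?thesis using B(3) card_image[OF inj] by simp
qed

text \<open>Take orthonormal bases \<open>B\<close> of \<open>span W\<close> and \<open>C\<close> of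
  its orthogonal complement as rows. The dimension bound leaves at least
  \<open>CARD('m) - CARD('k)\<close> vectors in \<open>C\<close>, enough to fill every row outside
  \<open>range e\<close>; the other vectors are distributed over \<open>range e\<close>.\<close>

lemma orthogonal_matrix_annihilating:
  fixes e :: "'k::finite \<Rightarrow> 'm::finite" and W :: "(real^'m) set"
  assumes inj: "inj e" and dim: "dim W \<le> CARD('k)"
  obtains A :: "real^'m^'m" where "orthogonal_matrix A" "\<And>i w. i \<notin> range e \<Longrightarrow> w \<in> W \<Longrightarrow> A $ i \<bullet> w = 0"
proof -
  define S where "S = span W"
  define S' where "S' = {y. \<forall>x\<in>S. orthogonal x y}"
  have "subspace S" unfolding S_def by simp
  then obtain B where B: "B \<subseteq> S" "pairwise orthogonal B" "\<And>x. x \<in> B \<Longrightarrow> norm x = 1" "independent B" "card B = dim S"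
    using orthonormal_basis_subspace[of S] by metis
  have "subspace S'" unfolding S'_def by (rule subspace_orthogonal_to_vectors)
  then obtain C where C: "C \<subseteq> S'" "pairwise orthogonal C" "\<And>x. x \<in> C \<Longrightarrow> norm x = 1" "independent C" "card C = dim S'"
    using orthonormal_basis_subspace[of S'] by metis
  have dimS: "dim S' + dim S = CARD('m)"
    using dim_subspace_orthogonal_to_vectors[of S UNIV] \<open>subspace S\<close> unfolding S'_def by simp
  have fin: "finite B" "finite C" using B(4) C(4) finiteI_independent by blast+
  have BC: "orthogonal x y" if "x \<in> B" "y \<in> C" for x y using that B(1) C(1) unfolding S'_def by blast
  have disj: "B \<inter> C = {}"
  proof (rule ccontr)
    assume "B \<inter> C \<noteq> {}"
    then obtain x where "x \<in> B" "x \<in> C" by blast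
    thus False using BC[of x x] B(3)[of x] by (auto simp: orthogonal_def)
  qed
  have cardBC: "card (B \<union> C) = CARD('m)" using card_Un_disjoint[OF fin disj] B(5) C(5) dimS by simp
  have crange: "card (range e) = CARD('k)" using card_image[OF inj] by simp
  have ccomp: "card (- range e) = CARD('m) - CARD('k)" unfolding Compl_eq_Diff_UNIV crange[symmetric] by (rule card_Diff_subset) auto
  have "card (- range e) \<le> card C" unfolding ccomp C(5) using dim dimS unfolding S_def by simp
  then obtain C' where C': "C' \<subseteq> C" "card C' = card (- range e)" using obtain_subset_with_card_n by metis
  obtain f where f: "bij_betw f (- range e) C'" using C'(2) fin finite_subset[OF C'(1)] finite_same_card_bij[of "- range e" C'] by auto
  have "card (B \<union> C - C') = card (B \<union> C) - card C'"
    by (rule card_Diff_subset) (use C' finite_subset[OF C'(1)] fin in auto)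
  moreover have "CARD('k) \<le> CARD('m)" using crange card_mono[of UNIV "range e"] by simp
  ultimately have "card (range e) = card (B \<union> C - C')" unfolding cardBC C'(2) ccomp crange by simp
  then obtain g where g: "bij_betw g (range e) (B \<union> C - C')"
    using fin finite_same_card_bij[of "range e" "B \<union> C - C'"] by auto
  define \<beta> where "\<beta> i = (if i \<in> range e then g i else f i)" for i
  have \<beta>1: "bij_betw \<beta> (range e) (B \<union> C - C')" using g by (rule bij_betw_cong[THEN iffD1, rotated]) (simp add: \<beta>_def)
  have \<beta>2: "bij_betw \<beta> (- range e) C'" using f by (rule bij_betw_cong[THEN iffD1, rotated]) (simp add: \<beta>_def)
  have "bij_betw \<beta> (range e \<union> - range e) ((B \<union> C - C') \<union> C')"
    by (rule bij_betw_combine[OF \<beta>1 \<beta>2]) blast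
  hence \<beta>: "bij_betw \<beta> UNIV (B \<union> C)" using C'(1) by (simp add: Un_absorb2 sup.coboundedI2)
  have mem: "\<beta> i \<in> B \<union> C" for i using bij_betwE[OF \<beta>] by blast
  have "orthogonal (\<beta> i) (\<beta> j)" if "i \<noteq> j" for i j
  proof -
    have "\<beta> i \<noteq> \<beta> j" using \<beta> that unfolding bij_betw_def inj_on_def by blast
    thus ?thesis using mem[of i] mem[of j] B(2) C(2) BC orthogonal_commute unfolding pairwise_def by (metis Un_iff)
  qed
  moreover have "norm (\<beta> i) = 1" for i using mem[of i] B(3) C(3) by blast
  ultimately have "orthogonal_matrix (\<chi> i. \<beta> i)"
    unfolding orthogonal_matrix_orthonormal_rows by (simp add: row_def)
  moreover have "(\<chi> i. \<beta> i) $ i \<bullet> w = 0" if "i \<notin> range e" "w \<in> W" for i w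
  proof -
    have "\<beta> i \<in> S'" using bij_betwE[OF \<beta>2] that(1) C'(1) C(1) by blast
    moreover have "w \<in> S" unfolding S_def using that(2) by (rule span_base)
    ultimately have "orthogonal w (\<beta> i)" unfolding S'_def by blast
    thus ?thesis by (simp add: orthogonal_def inner_commute)
  qed
  ultimately show ?thesis using that by blast
qed

lemma inner_eq_Re_hprod: "Z \<bullet> W = Re (hprod Z W)"
  by (simp add: inner_vec_def hprod_def inner_complex_def)

text \<open>The hypothesis says that \<open>F z\<close> has the same Gram matrix as the pair of
  \<open>z\<close> and \<open>f z\<close> in a space of real dimension \<open>2 n + 2\<close>, so
  the real span of all \<open>F z\<close> and \<open>\<i> F z\<close> has at most that
  dimension.\<close>

lemma real_rotation_into_coordinates:
  fixes F :: "complex^'n \<Rightarrow> complex^'m" and e :: "'k::finite \<Rightarrow> 'm"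
  assumes gram: "\<And>z w. z \<in> S \<Longrightarrow> w \<in> S \<Longrightarrow> hprod (F z) (F w) = hprod z w + f z * cnj (f w)"
    and card: "CARD('k) = 2 * CARD('n) + 2" and inj: "inj e"
  obtains A where "orthogonal_matrix A" "\<And>z i. z \<in> S \<Longrightarrow> i \<notin> range e \<Longrightarrow> real_lin A (F z) $ i = 0"
proof -
  define u where "u = (\<lambda>(z, c). c *s F z)"
  define v where "v = (\<lambda>(z, c). (c *s z, c * f z))"
  \<comment> \<open>The factor \<i> serves a second end: the real parts of \<open>F z\<close> and
    \<open>\<i> F z\<close> are \<open>Re F\<close> and \<open>- Im F\<close>, so a real row
    vanishing on them annihilates the complex vector \<open>F z\<close>.\<close>
  define I where "I = S \<times> {1, \<i>}"
  have "u i \<bullet> u j = v i \<bullet> v j" if ij: "i \<in> I" "j \<in> I" for i j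
  proof -
    obtain z c w c' where i: "i = (z, c)" "j = (w, c')" by (metis prod.exhaust)
    have "u i \<bullet> u j = Re (c * cnj c' * (hprod z w + f z * cnj (f w)))"
      using ij gram[of z w] unfolding i u_def I_def by (simp add: inner_eq_Re_hprod hprod_smult_left hprod_smult_right algebra_simps)
    also have "\<dots> = Re (hprod (c *s z) (c' *s w)) + Re ((c * f z) * cnj (c' * f w))"
      by (simp only: hprod_smult_left hprod_smult_right plus_complex.sel[symmetric]) (simp add: algebra_simps)
    also have "\<dots> = v i \<bullet> v j"
      unfolding i v_def by (simp add: inner_eq_Re_hprod inner_complex_def algebra_simps)
    finally show ?thesis .
  qed
  hence "dim (u ` I) \<le> DIM((complex^'n) \<times> complex)" by (rule dim_le_of_equal_inner)
  moreover have "DIM((complex^'n) \<times> complex) = CARD('k)" using card by simp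
  ultimately have du: "dim (u ` I) \<le> CARD('k)" by simp
  define R where "R = (\<lambda>Z::complex^'m. \<chi> i. Re (Z $ i))"
  have "linear R" unfolding R_def by (rule linearI) (simp_all add: vec_eq_iff)
  hence "dim (R ` u ` I) \<le> CARD('k)" using dim_image_le[of R "u ` I"] du by simp
  from orthogonal_matrix_annihilating[OF inj this] obtain A
    where A: "orthogonal_matrix A" "\<And>i w. i \<notin> range e \<Longrightarrow> w \<in> R ` u ` I \<Longrightarrow> A $ i \<bullet> w = 0" by blast
  have "real_lin A (F z) $ i = 0" if z: "z \<in> S" and i: "i \<notin> range e" for z i
  proof (rule complex_eqI)
    have "R (u (z, 1)) \<in> R ` u ` I" "R (u (z, \<i>)) \<in> R ` u ` I" using z unfolding I_def by blast+
    from this[THEN A(2)[OF i]] 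
    show "Re (real_lin A (F z) $ i) = Re 0" "Im (real_lin A (F z) $ i) = Im 0"
      unfolding R_def u_def real_lin_def rprod_def inner_vec_def by (simp_all add: sum_negf)
  qed
  thus ?thesis using A(1) that by blast
qed

subsection \<open>The functional equation\<close>

text \<open>The metric equation is known for \<open>F\<close>, the normalisation at 0 for
  \<open>f\<close> after \<open>F\<close>. \<open>disc_potential\<close> is therefore applied to
  \<open>F\<close>, and the result is carried over by the automorphy factor \<open>d\<close>, which
  only changes the holomorphic factor that \<open>disc_normalised\<close> removes.\<close>

lemma normalised_isometry_gen_norm:
  fixes F :: "complex^'n \<Rightarrow> complex^'m"
  assumes hol: "holo_map F unit_ball" and sub: "F ` unit_ball \<subseteq> typeIV"
    and eq: "\<And>z v. z \<in> unit_ball \<Longrightarrow> levi_form (F z) (frechet_derivative F (at z) v)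
     = - \<mu> * (zzbar v / (1 - zzbar z) + (cmod (hprod v z))\<^sup>2 / (1 - zzbar z)\<^sup>2)"
    and f: "gen_aut f d" "f (F 0) = 0" and z: "z \<in> unit_ball"
  shows "gen_norm (f (F z)) = (1 - zzbar z) powr \<mu>"
proof (cases "z = 0")
  case True
  thus ?thesis by (simp add: f gen_norm_def zzbar_def zzt_def)
next
  case False
  define t where "t = sqrt (zzbar z)"
  have z0: "zzbar z > 0" using False zzbar_eq_0_iff[of z] zzbar_nonneg[of z] by linarith
  hence t: "t > 0" "t\<^sup>2 = zzbar z" unfolding t_def by auto
  define v where "v = of_real (1 / t) *s z"
  have zv: "z = of_real t *s v" unfolding v_def using t by (simp add: vector_smult_assoc)
  have v: "zzbar v = 1" unfolding v_def zzbar_smult norm_of_real power2_abs using t z0 by (simp add: power_divide)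
  have inb: "0 + x *s v \<in> unit_ball" if "x \<in> ball 0 1" for x
  proof -
    have "(cmod x)\<^sup>2 < 1\<^sup>2" using that by (intro power_strict_mono) auto
    thus ?thesis unfolding unit_ball_iff by (simp add: zzbar_smult v)
  qed
  define P where "P = (\<lambda>i x. F (0 + x *s v) $ i)"
  define q where "q = (\<lambda>x. zzt (F (0 + x *s v)) / 2)"
  have N: "1 - (\<Sum>i\<in>UNIV. (cmod (P i x))\<^sup>2) + (cmod (q x))\<^sup>2 = gen_norm (F (0 + x *s v))" for x
    unfolding gen_norm_eq P_def q_def ..
  have memIV: "F (0 + x *s v) \<in> typeIV" if "x \<in> ball 0 1" for x using sub inb[OF that] by blast
  have holP: "P i holomorphic_on ball 0 1" for i unfolding P_def by (rule holo_map_line[OF hol inb])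
  have holq: "q holomorphic_on ball 0 1" unfolding q_def by (rule holo_map_line_zzt[OF hol inb])
  obtain h where h: "h holomorphic_on ball 0 1"
    "\<And>x. x \<in> ball 0 1 \<Longrightarrow> 1 - (\<Sum>i\<in>UNIV. (cmod (P i x))\<^sup>2) + (cmod (q x))\<^sup>2 = (cmod (exp (h x)))\<^sup>2 * (1 - (cmod x)\<^sup>2) powr \<mu>"
  proof (rule disc_potential[OF holP holq])
    fix x :: complex assume x: "x \<in> ball 0 1"
    show "1 - (\<Sum>i\<in>UNIV. (cmod (P i x))\<^sup>2) + (cmod (q x))\<^sup>2 > 0"
      unfolding N using memIV[OF x] typeIV_iff by blast
    define w where "w = frechet_derivative F (at (0 + x *s v)) v"
    have s: "((\<lambda>x. F (0 + x *s v) $ i) has_field_derivative w $ i) (at x)" for i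
      unfolding w_def by (rule holo_map_slice[OF hol inb[OF x]])
    have dP: "deriv (P i) x = w $ i" for i
      unfolding P_def by (rule DERIV_imp_deriv[OF s])
    have dq: "deriv q x = bprod (F (0 + x *s v)) w"
      unfolding q_def
      by (rule DERIV_imp_deriv) (use DERIV_cdivide[OF has_field_derivative_zzt[OF s], of 2] in simp)
    have "(- (\<Sum>i\<in>UNIV. (cmod (deriv (P i) x))\<^sup>2) + (cmod (deriv q x))\<^sup>2) / (1 - (\<Sum>i\<in>UNIV. (cmod (P i x))\<^sup>2) + (cmod (q x))\<^sup>2)
      - (cmod (- (\<Sum>i\<in>UNIV. deriv (P i) x * cnj (P i x)) + deriv q x * cnj (q x)))\<^sup>2
         / (1 - (\<Sum>i\<in>UNIV. (cmod (P i x))\<^sup>2) + (cmod (q x))\<^sup>2)\<^sup>2 = levi_form (F (0 + x *s v)) w"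
      unfolding N dP dq levi_form_def by (simp add: zzbar_def hprod_def P_def q_def)
    also have "\<dots> = - \<mu> * (1 / (1 - (cmod x)\<^sup>2) + (cmod x)\<^sup>2 / (1 - (cmod x)\<^sup>2)\<^sup>2)"
      unfolding w_def eq[OF inb[OF x]] by (simp add: zzbar_smult v hprod_smult_right hprod_self norm_mult)
    also have "\<dots> = - \<mu> / (1 - (cmod x)\<^sup>2)\<^sup>2"
    proof -
      have "1 - (cmod x)\<^sup>2 \<noteq> 0" using inb[OF x] unfolding unit_ball_iff by (simp add: zzbar_smult v)
      hence "1 / (1 - (cmod x)\<^sup>2) + (cmod x)\<^sup>2 / (1 - (cmod x)\<^sup>2)\<^sup>2 = 1 / (1 - (cmod x)\<^sup>2)\<^sup>2"
        by (simp add: divide_simps power2_eq_square)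
      thus ?thesis by (simp only:) simp
    qed
    finally show "(- (\<Sum>i\<in>UNIV. (cmod (deriv (P i) x))\<^sup>2) + (cmod (deriv q x))\<^sup>2) / (1 - (\<Sum>i\<in>UNIV. (cmod (P i x))\<^sup>2) + (cmod (q x))\<^sup>2)
      - (cmod (- (\<Sum>i\<in>UNIV. deriv (P i) x * cnj (P i x)) + deriv q x * cnj (q x)))\<^sup>2
         / (1 - (\<Sum>i\<in>UNIV. (cmod (P i x))\<^sup>2) + (cmod (q x))\<^sup>2)\<^sup>2 = - \<mu> / (1 - (cmod x)\<^sup>2)\<^sup>2" .
  qed (rule that; assumption)
  have hf: "holo_map f typeIV" using f(1) unfolding gen_aut_def biholo_aut_def by blast
  have holfF: "holo_map (\<lambda>z. f (F z)) unit_ball" by (rule holo_map_compose[OF hol hf sub])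
  define g where "g = (\<lambda>x. exp (h x) / d (F (0 + x *s v)))"
  have d0: "d (F (0 + x *s v)) \<noteq> 0" "gen_norm (f (F (0 + x *s v))) * (cmod (d (F (0 + x *s v))))\<^sup>2 = gen_norm (F (0 + x *s v))"
    if "x \<in> ball 0 1" for x
    using f(1) memIV[OF that] unfolding gen_aut_def by auto
  \<comment> \<open>The scalar function is viewed as a map into \<open>complex^1\<close> so that
    \<open>holo_map_line\<close> applies to it.\<close>
  have "holo_map (\<lambda>z. vec (d (F z)) :: complex^1) unit_ball"
  proof (rule holo_mapI_components)
    fix y i assume y: "y \<in> (unit_ball :: (complex^'n) set)"
    have "holo_fun d (F y)" using f(1) sub y unfolding gen_aut_def by blast
    thus "holo_fun (\<lambda>z. (vec (d (F z)) :: complex^1) $ i) y" using holo_fun_compose[OF hol y] by simp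
  qed
  from holo_map_line[OF this inb] have hold: "(\<lambda>x. d (F (0 + x *s v))) holomorphic_on ball 0 1" by simp
  have holg: "g holomorphic_on ball 0 1"
    unfolding g_def by (intro holomorphic_intros h(1) hold d0)
  define P' where "P' = (\<lambda>i x. f (F (0 + x *s v)) $ i)"
  define q' where "q' = (\<lambda>x. zzt (f (F (0 + x *s v))) / 2)"
  have N': "1 - (\<Sum>i\<in>UNIV. (cmod (P' i x))\<^sup>2) + (cmod (q' x))\<^sup>2 = gen_norm (f (F (0 + x *s v)))" for x
    unfolding gen_norm_eq P'_def q'_def ..
  have "1 - (\<Sum>i\<in>UNIV. (cmod (P' i (of_real t)))\<^sup>2) + (cmod (q' (of_real t)))\<^sup>2 = (1 - (cmod (of_real t))\<^sup>2) powr \<mu>"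
  proof (rule disc_normalised)
    show "P' i holomorphic_on ball 0 1" for i unfolding P'_def by (rule holo_map_line[OF holfF inb])
    show "q' holomorphic_on ball 0 1" unfolding q'_def by (rule holo_map_line_zzt[OF holfF inb])
    show "g holomorphic_on ball 0 1" by (rule holg)
    show "P' i 0 = 0" "q' 0 = 0" for i unfolding P'_def q'_def by (simp_all add: f zzt_def)
    show "complex_of_real t \<in> ball 0 1"
      using z t unfolding unit_ball_iff by (simp add: t_def)
    show "1 - (\<Sum>i\<in>UNIV. (cmod (P' i x))\<^sup>2) + (cmod (q' x))\<^sup>2 = (cmod (g x))\<^sup>2 * (1 - (cmod x)\<^sup>2) powr \<mu>"
      if x: "x \<in> ball 0 1" for x
      using d0[OF x] h(2)[OF x] unfolding N N' g_def by (simp add: norm_divide power_divide field_simps)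
  qed
  thus ?thesis unfolding N' using t by (simp add: zv[symmetric])
qed

text \<open>On the complex line through \<open>z\<close> and \<open>w\<close> let \<open>a\<close>
  be the point nearest to 0 and \<open>b\<close> a unit direction. Orthogonality gives
  \<open>|a + x b|^2 = |a|^2 + |x|^2\<close>, so the line cuts the ball in a disc of radius
  \<open>sqrt (1 - |a|^2)\<close>, where the norm identity is polarized with
  \<open>g = 1\<close>.\<close>

lemma ball_pairing_distinct:
  fixes F :: "complex^'n \<Rightarrow> complex^'m"
  assumes hol: "holo_map F unit_ball"
    and eq: "\<And>z. z \<in> unit_ball \<Longrightarrow> gen_norm (F z) = (1 - zzbar z) powr \<mu>"
    and z: "z \<in> unit_ball" and w: "w \<in> unit_ball" and zw: "z \<noteq> w"
  shows "1 - hprod (F z) (F w) + zzt (F z) / 2 * cnj (zzt (F w) / 2) = (1 - hprod z w) powr of_real \<mu>"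
proof -
  define t where "t = sqrt (zzbar (z - w))"
  have zw0: "zzbar (z - w) > 0" using zw zzbar_eq_0_iff[of "z - w"] zzbar_nonneg[of "z - w"] by (simp add: less_le)
  hence t: "t > 0" "t\<^sup>2 = zzbar (z - w)" unfolding t_def by auto
  define b where "b = of_real (1 / t) *s (z - w)"
  have b: "zzbar b = 1" unfolding b_def zzbar_smult norm_of_real power2_abs using t zw0 by (simp add: power_divide)
  define a where "a = z + (- hprod z b) *s b"
  have za: "z = a + hprod z b *s b" unfolding a_def by (simp add: vec_eq_iff)
  have ab: "hprod a b = 0" unfolding a_def hprod_add_left hprod_smult_left hprod_self b by simp
  hence ba: "hprod b a = 0" using cnj_hprod[of a b] by simp
  define y where "y = hprod z b - of_real t"
  have "z - w = of_real t *s b" unfolding b_def using t by (simp add: vector_smult_assoc)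
  hence "w = z - of_real t *s b" by (simp add: algebra_simps)
  hence wa: "w = a + y *s b" unfolding y_def a_def by (simp add: vec_eq_iff algebra_simps)
  have hp: "hprod (a + x *s b) (a + x' *s b) = of_real (zzbar a) + x * cnj x'" for x x'
    by (simp add: hprod_add_left hprod_add_right hprod_smult_left hprod_smult_right ab ba hprod_self b)
  have zb: "zzbar (a + x *s b) = zzbar a + (cmod x)\<^sup>2" for x
  proof -
    have "complex_of_real (zzbar (a + x *s b)) = of_real (zzbar a + (cmod x)\<^sup>2)"
      unfolding hprod_self[symmetric] hp of_real_add complex_norm_square ..
    thus ?thesis by (simp only: of_real_eq_iff)
  qed
  have "zzbar a + (cmod (hprod z b))\<^sup>2 < 1" using z za zb[of "hprod z b"] unfolding unit_ball_iff by simp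
  hence a1: "zzbar a < 1" by (smt (verit) zero_le_power2)
  define \<rho> where "\<rho> = sqrt (1 - zzbar a)"
  have \<rho>: "\<rho> > 0" "\<rho>\<^sup>2 = 1 - zzbar a" unfolding \<rho>_def using a1 by auto
  have inb: "a + x *s b \<in> unit_ball \<longleftrightarrow> x \<in> ball 0 \<rho>" for x
  proof -
    have "a + x *s b \<in> unit_ball \<longleftrightarrow> (cmod x)\<^sup>2 < \<rho>\<^sup>2" unfolding unit_ball_iff zb \<rho>(2) by auto
    also have "\<dots> \<longleftrightarrow> x \<in> ball 0 \<rho>" using \<rho>(1) power2_less_imp_less[of "cmod x" \<rho>] power_strict_mono[of "cmod x" \<rho> 2] by auto
    finally show ?thesis .
  qed
  have "1 - (\<Sum>i\<in>UNIV. F (a + hprod z b *s b) $ i * cnj (F (a + y *s b) $ i)) + zzt (F (a + hprod z b *s b)) / 2 * cnj (zzt (F (a + y *s b)) / 2)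
    = 1 * cnj 1 * (of_real (1 - zzbar a) - hprod z b * cnj y) powr of_real \<mu>"
  proof (rule polarized_norm_identity[where \<rho>=\<rho> and P="\<lambda>i x. F (a + x *s b) $ i" and q="\<lambda>x. zzt (F (a + x *s b)) / 2" and g="\<lambda>x. 1"])
    show "(\<lambda>x. F (a + x *s b) $ i) holomorphic_on ball 0 \<rho>" for i
      by (rule holo_map_line[OF hol]) (simp only: inb)
    show "(\<lambda>x. zzt (F (a + x *s b)) / 2) holomorphic_on ball 0 \<rho>"
      by (rule holo_map_line_zzt[OF hol]) (simp only: inb)
    show "hprod z b \<in> ball 0 \<rho>" unfolding inb[symmetric] za[symmetric] by (rule z)
    show "y \<in> ball 0 \<rho>" unfolding inb[symmetric] wa[symmetric] by (rule w)
    show "1 - (\<Sum>i\<in>UNIV. (cmod (F (a + x *s b) $ i))\<^sup>2) + (cmod (zzt (F (a + x *s b)) / 2))\<^sup>2 = (cmod 1)\<^sup>2 * (1 - zzbar a - (cmod x)\<^sup>2) powr \<mu>"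
      if "x \<in> ball 0 \<rho>" for x
      using eq[OF inb[THEN iffD2, OF that]] unfolding gen_norm_eq zb by (simp add: diff_diff_eq)
  qed (use \<rho> in auto)
  also have "of_real (1 - zzbar a) - hprod z b * cnj y = 1 - hprod z w"
    using hp[of "hprod z b" y] unfolding za[symmetric] wa[symmetric] by simp
  finally show ?thesis unfolding za[symmetric] wa[symmetric] hprod_def[of "F z" "F w"] by simp
qed

lemma ball_pairing:
  fixes F :: "complex^'n \<Rightarrow> complex^'m"
  assumes hol: "holo_map F unit_ball"
    and eq: "\<And>z. z \<in> unit_ball \<Longrightarrow> gen_norm (F z) = (1 - zzbar z) powr \<mu>"
    and z: "z \<in> unit_ball" and w: "w \<in> unit_ball"
  shows "1 - hprod (F z) (F w) + zzt (F z) / 2 * cnj (zzt (F w) / 2) = (1 - hprod z w) powr of_real \<mu>"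
proof (cases "z = w")
  case True
  have "zzbar w < 1" using w unit_ball_iff by blast
  hence "(1 - hprod w w) powr of_real \<mu> = of_real ((1 - zzbar w) powr \<mu>)"
    unfolding hprod_self using powr_of_real[of "1 - zzbar w" \<mu>] by simp
  moreover have "1 - hprod (F w) (F w) + zzt (F w) / 2 * cnj (zzt (F w) / 2) = of_real (gen_norm (F w))"
    unfolding gen_norm_def hprod_self of_real_add of_real_diff of_real_mult complex_norm_square by simp
  ultimately show ?thesis unfolding True eq[OF w] by simp
next
  case False
  thus ?thesis using ball_pairing_distinct[OF hol eq z w] by blast
qed

lemma isometric_constant_eq_1:
  fixes F :: "complex^'n \<Rightarrow> complex^'m"
  assumes n: "CARD('n) \<ge> 2" and \<mu>: "\<mu> > 0" and hol: "holo_map F unit_ball"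
    and pair: "\<And>z w. z \<in> unit_ball \<Longrightarrow> w \<in> unit_ball \<Longrightarrow>
       1 - hprod (F z) (F w) + zzt (F z) / 2 * cnj (zzt (F w) / 2) = (1 - hprod z w) powr of_real \<mu>"
  shows "\<mu> = 1"
proof -
  obtain j1 j2 :: 'n where j: "j1 \<noteq> j2"
  proof -
    have "\<not> card (UNIV :: 'n set) \<le> Suc 0" using n by simp
    thus ?thesis using that card_le_Suc0_iff_eq[of "UNIV :: 'n set"] by auto
  qed
  have hpa: "hprod (x *s axis j 1) (y *s axis j' 1) = (if j = j' then 1 else 0) * x * cnj y" for x y and j j' :: 'n
  proof -
    have "(axis j 1 :: complex^'n) $ i * cnj ((axis j' 1 :: complex^'n) $ i) = (if i = j then if j = j' then 1 else 0 else 0)" for i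
      by (simp add: axis_def)
    hence "hprod (axis j 1) (axis j' 1) = (if j = j' then 1 else 0)" unfolding hprod_def by simp
    thus ?thesis unfolding hprod_smult_left hprod_smult_right by simp
  qed
  have za: "zzbar (x *s axis j (1::complex) :: complex^'n) = (cmod x)\<^sup>2" for x j
  proof -
    have "complex_of_real (zzbar (x *s axis j (1::complex) :: complex^'n)) = of_real ((cmod x)\<^sup>2)"
      unfolding hprod_self[symmetric] hpa complex_norm_square by simp
    thus ?thesis by (simp only: of_real_eq_iff)
  qed
  have inb: "0 + x *s axis j 1 \<in> (unit_ball :: (complex^'n) set)" if "x \<in> ball 0 1" for x j
  proof -
    have "(cmod x)\<^sup>2 < 1\<^sup>2" using that by (intro power_strict_mono) auto
    thus ?thesis unfolding unit_ball_iff by (simp add: za)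
  qed
  define A where "A j k = (\<chi> i. (deriv ^^ k) (\<lambda>x. F (0 + x *s axis j 1) $ i) 0)" for j k
  define a where "a j k = (deriv ^^ k) (\<lambda>x. zzt (F (0 + x *s axis j 1)) / 2) 0" for j k
  have gram: "hprod (A j k) (A j' l) = a j k * cnj (a j' l)
      - (if k = l then (if j = j' then 1 else 0) * of_real (pochhammer (- \<mu>) k * fact k) else 0)"
    if "k > 0" "l > 0" for j j' k l
    unfolding hprod_def A_def a_def vec_lambda_beta
  proof (rule taylor_gram[OF holo_map_line[OF hol inb] holo_map_line_zzt[OF hol inb] holo_map_line[OF hol inb] holo_map_line_zzt[OF hol inb]])
    fix x y :: complex assume xy: "x \<in> ball 0 1" "y \<in> ball 0 1"
    show "1 - (\<Sum>i\<in>UNIV. F (0 + x *s axis j 1) $ i * cnj (F (0 + y *s axis j' 1) $ i)) +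
       zzt (F (0 + x *s axis j 1)) / 2 * cnj (zzt (F (0 + y *s axis j' 1)) / 2) = (1 - (if j = j' then 1 else 0) * x * cnj y) powr of_real \<mu>"
      using pair[OF inb[OF xy(1), of j] inb[OF xy(2), of j']] unfolding add_0 hpa unfolding hprod_def .
  qed (use that in auto)
  have "\<not> \<mu> < 1"
  proof
    assume "\<mu> < 1"
    show False
    proof (rule no_infinite_gram[of "A j1" "a j1" "\<lambda>k. - (pochhammer (- \<mu>) k * fact k)"])
      show "hprod (A j1 k) (A j1 l) = a j1 k * cnj (a j1 l) + (if k = l then of_real (- (pochhammer (- \<mu>) k * fact k)) else 0)"
        if "k > 0" "l > 0" for k l
        using gram[OF that, of j1 j1] by simp
      show "- (pochhammer (- \<mu>) k * fact k) > 0" if "k > 0" for k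
        using pochhammer_minus_neg[OF \<mu> \<open>\<mu> < 1\<close> that] by (simp add: mult_neg_pos)
    qed
  qed
  moreover have "\<not> \<mu> > 1"
  proof
    assume \<mu>1: "\<mu> > 1"
    \<comment> \<open>Order two is the lowest at which \<open>pochhammer (- \<mu>)\<close> is
      positive when \<mu> > 1.\<close>
    define c where "c = 2 * (\<mu> * (\<mu> - 1))"
    have c: "c > 0" unfolding c_def using \<mu>1 by simp
    have p2: "pochhammer (- \<mu>) 2 * fact 2 = c" unfolding c_def by (simp add: numeral_2_eq_2 pochhammer_Suc algebra_simps)
    have zb: "zzbar (A j 2) = (cmod (a j 2))\<^sup>2 - c" for j
    proof -
      have "complex_of_real (zzbar (A j 2)) = of_real ((cmod (a j 2))\<^sup>2 - c)"
        unfolding hprod_self[symmetric] of_real_diff complex_norm_square using gram[of 2 2 j j] unfolding p2 by simp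
      thus ?thesis by (simp only: of_real_eq_iff)
    qed
    have "hprod (A j1 2) (A j2 2) = a j1 2 * cnj (a j2 2)" using gram[of 2 2 j1 j2] j by simp
    hence "(cmod (a j1 2))\<^sup>2 * (cmod (a j2 2))\<^sup>2 \<le> ((cmod (a j1 2))\<^sup>2 - c) * ((cmod (a j2 2))\<^sup>2 - c)"
      using hprod_Cauchy_Schwarz[of "A j1 2" "A j2 2"] unfolding zb by (simp add: norm_mult power_mult_distrib)
    hence "c * ((cmod (a j1 2))\<^sup>2 + (cmod (a j2 2))\<^sup>2) \<le> c * c" by (simp add: algebra_simps)
    hence "(cmod (a j1 2))\<^sup>2 + (cmod (a j2 2))\<^sup>2 \<le> c" using c by simp
    \<comment> \<open>Both squares are at least \<open>c\<close>, yet Cauchy-Schwarz bounds their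
      sum by \<open>c\<close>.\<close>
    moreover have "(cmod (a j1 2))\<^sup>2 - c \<ge> 0" "(cmod (a j2 2))\<^sup>2 - c \<ge> 0" using zb zzbar_nonneg by metis+
    ultimately show False using c by linarith
  qed
  ultimately show ?thesis by linarith
qed

lemma sum_supported_on_range:
  fixes e :: "'k::finite \<Rightarrow> 'm::finite"
  assumes "inj e" "\<And>i. i \<notin> range e \<Longrightarrow> h i = 0"
  shows "(\<Sum>k\<in>UNIV. h (e k)) = (\<Sum>i\<in>UNIV. h i)"
proof -
  have "(\<Sum>i\<in>UNIV. h i) = (\<Sum>i\<in>range e. h i)"
    by (rule sum.mono_neutral_right) (use assms(2) in auto)
  thus ?thesis using sum.reindex[OF assms(1), of h] by simp
qed

theorem mainTheorem1:
  fixes F :: "complex^'n \<Rightarrow> complex^'m"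
    and e :: "'k::finite \<Rightarrow> 'm"
  assumes "CARD('n) \<ge> 2"
    and "CARD('m) > 2 * CARD('n) + 2"
    and "CARD('k) = 2 * CARD('n) + 2"
    and "inj e"
    and "holo_isometry F unit_ball log_bergman_ball typeIV log_bergman_typeIV"
  shows "\<exists>G :: complex^'n \<Rightarrow> complex^'k.
           holo_isometry G unit_ball log_bergman_ball typeIV log_bergman_typeIV
         \<and> equiv_maps F (\<lambda>z. pad e (G z))"
proof -
  have hol: "holo_map F unit_ball" and sub: "F ` unit_ball \<subseteq> typeIV"
    using assms(5) unfolding holo_isometry_def by auto
  obtain \<mu> where \<mu>: "\<mu> > 0" and levi: "\<And>z v. z \<in> unit_ball \<Longrightarrow> levi_form (F z) (frechet_derivative F (at z) v)
     = - \<mu> * (zzbar v / (1 - zzbar z) + (cmod (hprod v z))\<^sup>2 / (1 - zzbar z)\<^sup>2)"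
    using isometry_levi_form[OF assms(5)] by blast
  have "F 0 \<in> typeIV" using sub by (auto simp: unit_ball_def)
  from gen_aut_transitive[OF this] obtain f d where f: "gen_aut f d" "f (F 0) = 0" by blast
  define F1 where "F1 = (\<lambda>z. f (F z))"
  have hf: "holo_map f typeIV" using f(1) unfolding gen_aut_def biholo_aut_def by blast
  have hol1: "holo_map F1 unit_ball" unfolding F1_def by (rule holo_map_compose[OF hol hf sub])
  have sub1: "F1 z \<in> typeIV" if "z \<in> unit_ball" for z
    unfolding F1_def using gen_aut_mem[OF f(1)] sub that by blast
  have norm1: "gen_norm (F1 z) = (1 - zzbar z) powr \<mu>" if "z \<in> unit_ball" for z
    unfolding F1_def by (rule normalised_isometry_gen_norm[OF hol sub levi f that])
  have pair: "1 - hprod (F1 z) (F1 w) + zzt (F1 z) / 2 * cnj (zzt (F1 w) / 2) = (1 - hprod z w) powr of_real \<mu>"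
    if "z \<in> unit_ball" "w \<in> unit_ball" for z w
    by (rule ball_pairing[OF hol1 norm1 that])
  have \<mu>1: "\<mu> = 1" by (rule isometric_constant_eq_1[OF assms(1) \<mu> hol1 pair])
  have norm2: "gen_norm (F1 z) = 1 - zzbar z" if "z \<in> unit_ball" for z
    using norm1[OF that] that unfolding \<mu>1 unit_ball_iff by simp
  have gram: "hprod (F1 z) (F1 w) = hprod z w + zzt (F1 z) / 2 * cnj (zzt (F1 w) / 2)"
    if "z \<in> unit_ball" "w \<in> unit_ball" for z w
  proof -
    have "1 - hprod (F1 z) (F1 w) + zzt (F1 z) / 2 * cnj (zzt (F1 w) / 2) = (1 - hprod z w) powr 1"
      using pair[OF that] unfolding \<mu>1 by simp
    \<comment> \<open>The case distinction covers the separate value of \<open>powr\<close> at base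
      0, which is 0 and agrees as well.\<close>
    also have "\<dots> = 1 - hprod z w" by (cases "1 - hprod z w = 0") simp_all
    finally show ?thesis by (simp add: algebra_simps)
  qed
  obtain A where A: "orthogonal_matrix A" "\<And>z i. z \<in> unit_ball \<Longrightarrow> i \<notin> range e \<Longrightarrow> real_lin A (F1 z) $ i = 0"
    using real_rotation_into_coordinates[OF gram assms(3,4)] by blast
  note gA = gen_aut_real_lin[OF A(1)]
  have AA: "transpose A ** A = mat 1" using A(1) unfolding orthogonal_matrix_def by simp
  define G where "G = (\<lambda>z. \<chi> k. real_lin A (F1 z) $ e k)"
  have zz: "zzbar (G z) = zzbar (F1 z)" "zzt (G z) = zzt (F1 z)" if "z \<in> unit_ball" for z
  proof -
    show "zzbar (G z) = zzbar (F1 z)"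
      using sum_supported_on_range[OF assms(4), of "\<lambda>i. (cmod (real_lin A (F1 z) $ i))\<^sup>2"] A(2)[OF that]
        zzbar_real_lin[OF AA, of "F1 z"]
      unfolding zzbar_def G_def by simp
    show "zzt (G z) = zzt (F1 z)"
      using sum_supported_on_range[OF assms(4), of "\<lambda>i. (real_lin A (F1 z) $ i)\<^sup>2"] A(2)[OF that]
        zzt_real_lin[OF AA, of "F1 z"]
      unfolding zzt_def G_def by simp
  qed
  have "holo_isometry G unit_ball log_bergman_ball typeIV log_bergman_typeIV"
  proof (rule isometryI_gen_norm)
    have "holo_map (\<lambda>z. real_lin A (F1 z)) unit_ball"
      by (rule holo_map_compose[OF hol1 holo_map_real_lin subset_UNIV])
    thus "holo_map G unit_ball"
      unfolding G_def by (intro holo_mapI_components) (simp add: holo_map_component)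
    show "G ` unit_ball \<subseteq> typeIV"
      using sub1 zz by (auto simp: typeIV_def)
    show "gen_norm (G z) = 1 - zzbar z" if "z \<in> unit_ball" for z
      using norm2[OF that] zz[OF that] unfolding gen_norm_def by simp
  qed
  moreover have "equiv_maps F (\<lambda>z. pad e (G z))"
    unfolding equiv_maps_def
  proof (intro exI conjI ballI)
    \<comment> \<open>All normalisations took place in the target: the ball is left fixed, and the
      automorphism of the type IV domain is the inverse of \<open>f\<close> followed by the rotation
      \<open>A\<close>.\<close>
    show "biholo_aut (\<lambda>z. z) (unit_ball :: (complex^'n) set)"
      by (rule biholo_autI[where g="\<lambda>z. z"]) (auto intro!: holo_mapI_components holo_fun_nth)
    have b: "biholo_aut (\<lambda>Z. real_lin A (f Z)) typeIV"
      using gen_aut_comp[OF gA f(1)] unfolding gen_aut_def by blast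
    thus "biholo_aut (inv_into typeIV (\<lambda>Z. real_lin A (f Z))) typeIV"
      by (rule biholo_aut_inv_into[OF open_typeIV])
    fix z :: "complex^'n" assume z: "z \<in> unit_ball"
    have "pad e (G z) = real_lin A (f (F z))"
    proof (rule vec_eq_iff[THEN iffD2], rule allI)
      fix i
      show "pad e (G z) $ i = real_lin A (f (F z)) $ i"
      proof (cases "i \<in> range e")
        case True
        thus ?thesis using assms(4) by (auto simp: pad_def G_def F1_def)
      next
        case False
        thus ?thesis using A(2)[OF z False] by (simp add: pad_def F1_def)
      qed
    qed
    moreover have "F z \<in> typeIV" using sub z by blast
    hence "inv_into typeIV (\<lambda>Z. real_lin A (f Z)) (real_lin A (f (F z))) = F z"
      using b unfolding biholo_aut_def by (auto dest: bij_betw_inv_into_left)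
    ultimately show "F z = inv_into typeIV (\<lambda>Z. real_lin A (f Z)) (pad e (G z))" by simp
  qed
  ultimately show ?thesis by blast
qed

end
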